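(* Let $q\geq 1$ be an integer. Then there exist integers $a\ge 3$ and $l\ge 1$ such that for the monomial ideal $$I=I_{a,a}\,I_{2a,a}\cdots I_{la,a}\subset K[x_1,\ldots,x_l,y_1,\ldots,y_l],$$ where, for $j=1,\dots,l$, the factor $I_{ja,a}$ is (the extension to this ring of) the ideal $$I_{ja,a}=(x_j^{ja\cdot a},\,y_j^{ja\cdot a})(x_j^{a},\,y_j^{a})+(x_j,y_j)^{(ja+2)a-1}\subset K[x_j,y_j],$$ the function $f(k)=\mu(I^k)$, $k\geq 1$, has at least $q$ local maxima.
   Context: $K$ is a field, and $\mu(L)$ denotes the minimal number of generators of a graded ideal $L$ in a polynomial ring over $K$. In general, for integers $a\ge 3$, $m\ge 1$, and two variables $x,y$, one sets $I_{a,m}=(x^{am},y^{am})(x^{m},y^{m})+(x,y)^{(a+2)m-1}\subset K[x,y]$; the factors of $I$ above are such ideals with parameters $(ja,a)$, in polynomial rings in pairwise disjoint sets of variables. That $f$ has at least $q$ local maxima means: for $i=1,\ldots,q$ there exist positive integers $s_i<r_i<t_i$ such that the intervals $[s_i,t_i]$ are pairwise disjoint and $f(s_i)<f(r_i)>f(t_i)$ for $i=1,\ldots,q$. *)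

theory Defs
  imports "HOL-Algebra.Ideal_Product" "HOL-Library.Poly_Mapping" "HOL-Library.Disjoint_Sets"
begin

text \<open>Polynomials over 'k in indeterminates from the type 'v: finitely supported
  maps from monomials, i.e. finitely supported exponent vectors, to coefficients.
  Their arithmetic is the convolution arithmetic of the theory Poly-Mapping.\<close>

type_synonym ('v, 'k) mpol = "('v \<Rightarrow>\<^sub>0 nat) \<Rightarrow>\<^sub>0 'k"

definition var :: "'v \<Rightarrow> ('v, 'k::field) mpol" where
  "var v = Poly_Mapping.single (Poly_Mapping.single v 1) 1"

text \<open>The polynomial ring K[V], whose indeterminates are exactly the elements of V.\<close>

definition mpol_ring :: "'v set \<Rightarrow> ('v, 'k::field) mpol ring" where
  "mpol_ring V =
     \<lparr>carrier = {p. \<forall>t\<in>Poly_Mapping.keys p. Poly_Mapping.keys t \<subseteq> V},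
      mult = (*), one = 1, zero = 0, add = (+)\<rparr>"

lemma mpol_ring_simps [simp]:
  "\<one>\<^bsub>mpol_ring V\<^esub> = 1"
  "\<zero>\<^bsub>mpol_ring V\<^esub> = 0"
  "x \<otimes>\<^bsub>mpol_ring V\<^esub> y = x * y"
  "x \<oplus>\<^bsub>mpol_ring V\<^esub> y = x + y"
  by (simp_all add: mpol_ring_def)

lemma mem_mpol_ring_iff:
  "p \<in> carrier (mpol_ring V) \<longleftrightarrow> (\<forall>t\<in>Poly_Mapping.keys p. Poly_Mapping.keys t \<subseteq> V)"
  by (simp add: mpol_ring_def)

lemma var_in_mpol_ring: "v \<in> V \<Longrightarrow> var v \<in> carrier (mpol_ring V)"
  by (auto simp: mem_mpol_ring_iff var_def)

lemma mpol_ring_cring: "cring (mpol_ring V :: ('v, 'k::field) mpol ring)"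
proof -
  let ?R = "mpol_ring V :: ('v, 'k) mpol ring"
  have add: "p + q \<in> carrier ?R" if "p \<in> carrier ?R" "q \<in> carrier ?R" for p q
    using that keys_add[of p q] by (fastforce simp: mem_mpol_ring_iff)
  have mult: "p * q \<in> carrier ?R" if "p \<in> carrier ?R" "q \<in> carrier ?R" for p q
    unfolding mem_mpol_ring_iff
  proof
    fix t assume "t \<in> Poly_Mapping.keys (p * q)"
    then obtain a b where "t = a + b" "a \<in> Poly_Mapping.keys p" "b \<in> Poly_Mapping.keys q"
      using keys_mult[of p q] by blast
    then show "Poly_Mapping.keys t \<subseteq> V"
      using that keys_add[of a b] by (fastforce simp: mem_mpol_ring_iff)
  qed
  have neg: "- p \<in> carrier ?R" if "p \<in> carrier ?R" for p
    using that by (simp add: mem_mpol_ring_iff)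
  have "abelian_group ?R"
  proof (rule abelian_groupI)
    fix p assume "p \<in> carrier ?R"
    then show "\<exists>q\<in>carrier ?R. q \<oplus>\<^bsub>?R\<^esub> p = \<zero>\<^bsub>?R\<^esub>"
      using neg by (intro bexI[of _ "- p"]) auto
  qed (auto simp: add ac_simps, simp add: mem_mpol_ring_iff)
  moreover have "Group.comm_monoid ?R"
    by (rule comm_monoidI) (auto simp: mult ac_simps, simp add: mem_mpol_ring_iff)
  ultimately show ?thesis
    by (rule cringI) (simp add: distrib_right)
qed

text \<open>The minimal number of generators of a (finitely generated) ideal.\<close>

definition num_gens :: "('a, 'b) ring_scheme \<Rightarrow> 'a set \<Rightarrow> nat" where
  "num_gens R L = (LEAST n. \<exists>S. S \<subseteq> carrier R \<and> finite S \<and> card S = n \<and> Idl\<^bsub>R\<^esub> S = L)"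

text \<open>The ideal \<open>I\<close> of K[x, y] with parameters a, m. Products and powers of ideals are taken
  in the commutative monoid of ideals \<^const>\<open>ideals_set\<close>, and ideal sums are written with
  \<^const>\<open>set_add\<close>.\<close>

definition I_am :: "'v \<Rightarrow> 'v \<Rightarrow> nat \<Rightarrow> nat \<Rightarrow> ('v, 'k::field) mpol set" where
  "I_am x y a m =
     (let R = mpol_ring {x, y} in
       ((Idl\<^bsub>R\<^esub> {var x ^ (a * m), var y ^ (a * m)}) \<cdot>\<^bsub>R\<^esub> (Idl\<^bsub>R\<^esub> {var x ^ m, var y ^ m}))
         <+>\<^bsub>R\<^esub> ((Idl\<^bsub>R\<^esub> {var x, var y}) [^]\<^bsub>ideals_set R\<^esub> ((a + 2) * m - 1)))"

datatype xy = X nat | Y nat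

definition xy_vars :: "nat \<Rightarrow> xy set" where
  "xy_vars l = X ` {1..l} \<union> Y ` {1..l}"

text \<open>The outer \<^const>\<open>genideal\<close> is the extension of each factor from \<open>K[x\<^sub>j, y\<^sub>j]\<close>
  to the polynomial ring in all \<open>2 * l\<close> variables.\<close>

definition I_prod :: "nat \<Rightarrow> nat \<Rightarrow> (xy, 'k::field) mpol set" where
  "I_prod a l =
     (let R = mpol_ring (xy_vars l) in
       (\<Otimes>\<^bsub>ideals_set R\<^esub>j\<in>{1..l}. Idl\<^bsub>R\<^esub> (I_am (X j) (Y j) (j * a) a)))"

text \<open>Only values at positive arguments matter. The intervals are taken in the natural numbers;
  since their endpoints are integers, disjointness means the same as for real intervals.\<close>

definition has_local_maxima :: "nat \<Rightarrow> (nat \<Rightarrow> nat) \<Rightarrow> bool" where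
  "has_local_maxima q f \<longleftrightarrow>
     (\<exists>s r t :: nat \<Rightarrow> nat.
        (\<forall>i\<in>{1..q}. 0 < s i \<and> s i < r i \<and> r i < t i \<and> f (s i) < f (r i) \<and> f (r i) > f (t i)) \<and>
        disjoint_family_on (\<lambda>i. {s i..t i}) {1..q})"

end

theory Submission
  imports Complex_Main Defs "HOL-Library.Product_Plus" "HOL-Library.Set_Algebras"
    "HOL-Library.Function_Algebras"
begin

text \<open>For one factor, \<open>I\<^sup>k = J\<^sup>k + (x, y)\<^bsup>(A+1)mk+m-1\<^esup>\<close> with
  \<open>J = (x\<^bsup>Am\<^esup>, y\<^bsup>Am\<^esup>)(x\<^sup>m, y\<^sup>m)\<close>, where \<open>A = ja\<close> and \<open>m = a\<close>. Counting minimal monomials gives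
  \<open>\<mu>(I\<^sup>k) = (k + 1)\<^sup>2 + mk(A - 1 - k)\<close> for \<open>k < A\<close> and \<open>\<mu>(I\<^sup>k) = (A + 1)k + 1\<close> for \<open>k + 1 \<ge> A\<close>.
  The factors live in disjoint sets of variables, so for their product these numbers multiply.

  Put \<open>k = ca\<close> with \<open>p \<le> c < p + 1\<close> and let \<open>a\<close> grow. The factors with \<open>j \<le> p\<close> contribute
  \<open>jc a\<^sup>2\<close> and the others \<open>c(j - c) a\<^sup>3\<close>. If \<open>l\<close> is large compared with \<open>q\<close>, then for all
  \<open>p \<le> q\<close> the product of the leading coefficients increases from \<open>c = p\<close> to \<open>c = p + 1/2\<close>, whereas
  at \<open>k = (p + 1)a - 1\<close> the factor with \<open>j = p + 1\<close> has dropped to order \<open>a\<^sup>2\<close>. Hence each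
  interval from \<open>pa\<close> to \<open>(p + 1)a - 1\<close> contains a local maximum.\<close>

section \<open>Monomial ideals\<close>

lemma set_plus_memI: "a \<in> A \<Longrightarrow> b \<in> B \<Longrightarrow> c = a + b \<Longrightarrow> c \<in> A + B"
  by (simp add: set_plus_intro)

definition monoms :: "'v set \<Rightarrow> ('v \<Rightarrow>\<^sub>0 nat) set" where
  "monoms V = {t. Poly_Mapping.keys t \<subseteq> V}"

text \<open>\<open>U\<close> stands for all monomials of the ideal, not for generators, so this is
  an ideal only if \<open>U\<close> absorbs multiplication by monomials. Exponent vectors add when
  monomials multiply, hence set sums \<open>U + W\<close> encode products of ideals.\<close>

definition mon_ideal :: "('v \<Rightarrow>\<^sub>0 nat) set \<Rightarrow> ('v, 'k::field) mpol set" where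
  "mon_ideal U = {p. Poly_Mapping.keys p \<subseteq> U}"

lemma carrier_mpol_ring: "carrier (mpol_ring V) = mon_ideal (monoms V)"
  by (auto simp: mpol_ring_def mon_ideal_def monoms_def)

lemma zero_in_monoms [simp]: "0 \<in> monoms V"
  by (simp add: monoms_def)

lemma monoms_add: "s \<in> monoms V \<Longrightarrow> t \<in> monoms V \<Longrightarrow> s + t \<in> monoms V"
  using keys_add[of s t] by (auto simp: monoms_def)

lemma monoms_mono: "V \<subseteq> W \<Longrightarrow> monoms V \<subseteq> monoms W"
  by (auto simp: monoms_def)

lemma single_in_mon_ideal_iff:
  "Poly_Mapping.single t c \<in> mon_ideal U \<longleftrightarrow> c = 0 \<or> t \<in> U"
  by (auto simp: mon_ideal_def)

lemma mon_ideal_add: "p \<in> mon_ideal U \<Longrightarrow> q \<in> mon_ideal U \<Longrightarrow> p + q \<in> mon_ideal U"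
  using keys_add[of p q] by (auto simp: mon_ideal_def)

lemma mon_ideal_mult:
  assumes "p \<in> mon_ideal U" "q \<in> mon_ideal W"
  shows "p * q \<in> mon_ideal (U + W)"
  using assms keys_mult[of p q] by (fastforce simp: mon_ideal_def)

lemma mon_ideal_mono: "U \<subseteq> W \<Longrightarrow> mon_ideal U \<subseteq> mon_ideal W"
  by (auto simp: mon_ideal_def)

lemma ideal_mon_ideal:
  assumes "U \<subseteq> monoms V" "U + monoms V \<subseteq> U"
  shows "ideal (mon_ideal U) (mpol_ring V :: ('v, 'k::field) mpol ring)"
proof -
  let ?R = "mpol_ring V :: ('v, 'k) mpol ring"
  interpret cring ?R by (rule mpol_ring_cring)
  have mul: "p * x \<in> mon_ideal U" if "p \<in> mon_ideal U" "x \<in> carrier ?R" for p x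
    using mon_ideal_mult[of p U x "monoms V"] that mon_ideal_mono[OF assms(2)]
    by (auto simp: carrier_mpol_ring)
  show ?thesis
  proof (rule idealI)
    show "ring ?R" by (rule ring_axioms)
    show "subgroup (mon_ideal U) (add_monoid ?R)"
    proof (rule group.subgroupI)
      show "group (add_monoid ?R)" by (rule a_group)
      show "mon_ideal U \<subseteq> carrier (add_monoid ?R)"
        using mon_ideal_mono[OF assms(1)] by (simp add: carrier_mpol_ring)
      have "0 \<in> mon_ideal U" by (simp add: mon_ideal_def)
      then show "mon_ideal U \<noteq> {}" by blast
      fix p assume p: "p \<in> (mon_ideal U :: ('v, 'k) mpol set)"
      then have pc: "p \<in> carrier ?R"
        using mon_ideal_mono[OF assms(1)] by (auto simp: carrier_mpol_ring)
      have "\<ominus>\<^bsub>?R\<^esub> p = - p"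
      proof (rule minus_equality)
        show "- p \<in> carrier ?R" using pc by (simp add: mem_mpol_ring_iff)
      qed (use pc in auto)
      moreover have "- p \<in> mon_ideal U" using p by (simp add: mon_ideal_def)
      ultimately show "inv\<^bsub>add_monoid ?R\<^esub> p \<in> mon_ideal U"
        by (simp add: a_inv_def)
    qed (auto simp: mon_ideal_add)
  qed (use mul in \<open>auto simp: mult.commute\<close>)
qed

text \<open>A polynomial is the finite sum of its terms, and each term is a constant times a
  monomial of \<open>I\<close>. This lets an abstractly given ideal be compared with a monomial
  ideal by testing monomials alone.\<close>

lemma mon_ideal_subsetI:
  assumes I: "ideal I (mpol_ring V :: ('v, 'k::field) mpol ring)"
    and U: "U \<subseteq> monoms V" "\<And>t. t \<in> U \<Longrightarrow> Poly_Mapping.single t 1 \<in> I"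
  shows "mon_ideal U \<subseteq> I"
proof
  fix p :: "('v, 'k) mpol" assume "p \<in> mon_ideal U"
  interpret ideal I "mpol_ring V :: ('v, 'k) mpol ring" by (rule I)
  have sub: "additive_subgroup I (mpol_ring V :: ('v, 'k) mpol ring)" by (rule ideal.axioms(1)[OF I])
  have zero: "0 \<in> I" using additive_subgroup.zero_closed[OF sub] by simp
  have add: "x + y \<in> I" if "x \<in> I" "y \<in> I" for x y
    using additive_subgroup.a_closed[OF sub that] by simp
  have single: "Poly_Mapping.single t c \<in> I" if "t \<in> U" for t c
  proof -
    have "Poly_Mapping.single 0 c \<in> carrier (mpol_ring V :: ('v, 'k) mpol ring)"
      by (simp add: carrier_mpol_ring single_in_mon_ideal_iff)
    from I_l_closed[OF U(2)[OF that] this] show ?thesis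
      by (simp add: mult_single)
  qed
  show "p \<in> I" using \<open>p \<in> mon_ideal U\<close>
  proof (induction p rule: update_induct)
    case const
    show ?case by (rule zero)
  next
    case (update f t c)
    have eq: "Poly_Mapping.update t c f = f + Poly_Mapping.single t c"
      by (rule poly_mapping_eqI)
        (use update.hyps in \<open>auto simp: lookup_update lookup_add lookup_single in_keys_iff\<close>)
    have "insert t (Poly_Mapping.keys f) \<subseteq> U"
      using update.prems update.hyps by (simp add: mon_ideal_def keys_update)
    then show ?case unfolding eq
      by (intro add single update.IH) (auto simp: mon_ideal_def)
  qed
qed

section \<open>Generation, products and sums of monomial ideals\<close>

lemma Idl_single:
  assumes "G \<subseteq> monoms V"
  shows "Idl\<^bsub>mpol_ring V\<^esub> ((\<lambda>t. Poly_Mapping.single t (1::'k::field)) ` G) = mon_ideal (G + monoms V)"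
    (is "Idl\<^bsub>?R\<^esub> ?S = _")
proof -
  interpret cring ?R by (rule mpol_ring_cring)
  have sub: "G + monoms V \<subseteq> monoms V"
    using assms by (auto elim!: set_plus_elim intro: monoms_add)
  have S: "?S \<subseteq> carrier ?R"
    using assms by (auto simp: carrier_mpol_ring single_in_mon_ideal_iff)
  interpret I: ideal "Idl\<^bsub>?R\<^esub> ?S" ?R by (rule genideal_ideal[OF S])
  show ?thesis
  proof
    show "Idl\<^bsub>?R\<^esub> ?S \<subseteq> mon_ideal (G + monoms V)"
    proof (rule genideal_minimal[OF ideal_mon_ideal])
      show "G + monoms V + monoms V \<subseteq> G + monoms V"
        unfolding add.assoc[of G] by (intro set_plus_mono2) (auto elim!: set_plus_elim intro: monoms_add)
      have "g + 0 \<in> G + monoms V" if "g \<in> G" for g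
        using that zero_in_monoms by (rule set_plus_intro)
      then show "?S \<subseteq> mon_ideal (G + monoms V)"
        by (auto simp: single_in_mon_ideal_iff)
    qed (rule sub)
    show "mon_ideal (G + monoms V) \<subseteq> Idl\<^bsub>?R\<^esub> ?S"
    proof (rule mon_ideal_subsetI[OF I.is_ideal sub])
      fix t assume "t \<in> G + monoms V"
      then obtain g s where t: "t = g + s" and gs: "g \<in> G" "s \<in> monoms V" by (rule set_plus_elim)
      have "Poly_Mapping.single s 1 \<in> carrier ?R"
        using gs by (simp add: carrier_mpol_ring single_in_mon_ideal_iff)
      from I.I_r_closed[OF _ this, of "Poly_Mapping.single g 1"] genideal_self[OF S] gs
      show "Poly_Mapping.single t 1 \<in> Idl\<^bsub>?R\<^esub> ?S"
        by (auto simp: t mult_single)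
    qed
  qed
qed

text \<open>The set \<open>U\<close> need not absorb all of \<open>monoms V\<close>. This covers the
  extension of an ideal of a smaller polynomial ring, given by its own monomials, to the ring in the
  variables \<open>V\<close>.\<close>

lemma Idl_mon_ideal:
  assumes "U \<subseteq> monoms V"
  shows "Idl\<^bsub>mpol_ring V\<^esub> (mon_ideal U :: ('v, 'k::field) mpol set) = mon_ideal (U + monoms V)"
proof -
  let ?R = "mpol_ring V :: ('v, 'k) mpol ring"
  let ?S = "(\<lambda>t. Poly_Mapping.single t (1::'k)) ` U"
  interpret cring ?R by (rule mpol_ring_cring)
  have c: "mon_ideal U \<subseteq> carrier ?R"
    using mon_ideal_mono[OF assms] by (simp add: carrier_mpol_ring)
  have S: "?S \<subseteq> mon_ideal U" by (auto simp: single_in_mon_ideal_iff)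
  have "Idl\<^bsub>?R\<^esub> ?S \<subseteq> Idl\<^bsub>?R\<^esub> (mon_ideal U)" by (rule subset_Idl_subset[OF c S])
  moreover have "Idl\<^bsub>?R\<^esub> (mon_ideal U) \<subseteq> Idl\<^bsub>?R\<^esub> ?S"
  proof (rule genideal_minimal)
    show "ideal (Idl\<^bsub>?R\<^esub> ?S) ?R" using S c by (intro genideal_ideal) auto
    show "mon_ideal U \<subseteq> Idl\<^bsub>?R\<^esub> ?S"
      using genideal_self[of ?S] S c \<open>ideal (Idl\<^bsub>?R\<^esub> ?S) ?R\<close>
      by (intro mon_ideal_subsetI[OF _ assms]) auto
  qed
  ultimately show ?thesis using Idl_single[OF assms] by auto
qed

text \<open>The support of a product of polynomials lies in the sum of their supports. Conversely,
  each monomial in \<open>U + W\<close> is itself a product of a monomial in \<open>U\<close> and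
  one in \<open>W\<close>.\<close>

lemma ideal_prod_mon_ideal:
  assumes "U \<subseteq> monoms V" "U + monoms V \<subseteq> U" "W \<subseteq> monoms V" "W + monoms V \<subseteq> W"
  shows "mon_ideal U \<cdot>\<^bsub>mpol_ring V\<^esub> mon_ideal W = (mon_ideal (U + W) :: ('v, 'k::field) mpol set)"
proof -
  let ?R = "mpol_ring V :: ('v, 'k) mpol ring"
  interpret cring ?R by (rule mpol_ring_cring)
  note ideals = ideal_mon_ideal[OF assms(1,2)] ideal_mon_ideal[OF assms(3,4)]
  show ?thesis
  proof
    show "mon_ideal U \<cdot>\<^bsub>?R\<^esub> mon_ideal W \<subseteq> mon_ideal (U + W)"
    proof
      fix p assume "p \<in> mon_ideal U \<cdot>\<^bsub>?R\<^esub> mon_ideal W"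
      then show "p \<in> mon_ideal (U + W)"
        by induction (auto intro: mon_ideal_mult mon_ideal_add)
    qed
    show "mon_ideal (U + W) \<subseteq> mon_ideal U \<cdot>\<^bsub>?R\<^esub> mon_ideal W"
    proof (rule mon_ideal_subsetI)
      show "ideal (mon_ideal U \<cdot>\<^bsub>?R\<^esub> mon_ideal W) ?R" by (intro ideal_prod_is_ideal ideals)
      show "U + W \<subseteq> monoms V" using assms by (auto elim!: set_plus_elim intro: monoms_add)
      fix t assume "t \<in> U + W"
      then obtain u w where t: "t = u + w" "u \<in> U" "w \<in> W" by (rule set_plus_elim)
      then show "Poly_Mapping.single t 1 \<in> mon_ideal U \<cdot>\<^bsub>?R\<^esub> mon_ideal W"
        using ideal_prod.prod[of "Poly_Mapping.single u 1" "mon_ideal U"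
            "Poly_Mapping.single w 1" "mon_ideal W" ?R]
        by (simp add: single_in_mon_ideal_iff mult_single)
    qed
  qed
qed

lemma set_add_mon_ideal:
  "mon_ideal U <+>\<^bsub>mpol_ring V\<^esub> mon_ideal W = (mon_ideal (U \<union> W) :: ('v, 'k::field) mpol set)"
proof
  show "mon_ideal U <+>\<^bsub>mpol_ring V\<^esub> mon_ideal W \<subseteq> (mon_ideal (U \<union> W) :: ('v, 'k) mpol set)"
    using mon_ideal_mono[of U "U \<union> W"] mon_ideal_mono[of W "U \<union> W"]
    by (auto simp: set_add_def' intro!: mon_ideal_add)
  show "mon_ideal (U \<union> W) \<subseteq> mon_ideal U <+>\<^bsub>mpol_ring V\<^esub> (mon_ideal W :: ('v, 'k) mpol set)"
  proof
    fix p :: "('v, 'k) mpol" assume p: "p \<in> mon_ideal (U \<union> W)"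
    \<comment> \<open>The part of \<open>p\<close> supported in \<open>U\<close>; what remains is
      supported in \<open>W\<close>.\<close>
    define f where "f = Poly_Mapping.mapp (\<lambda>t c. c when t \<in> U) p"
    have "f \<in> mon_ideal U" "p - f \<in> mon_ideal W"
      using p by (auto simp: mon_ideal_def f_def in_keys_iff lookup_mapp lookup_minus when_def
          split: if_splits)
    moreover have "p = f + (p - f)" by simp
    ultimately show "p \<in> mon_ideal U <+>\<^bsub>mpol_ring V\<^esub> mon_ideal W"
      unfolding set_add_def' mpol_ring_simps by blast
  qed
qed

lemma var_power: "var x ^ n = Poly_Mapping.single (Poly_Mapping.single x n) 1"
  by (induction n) (auto simp: var_def mult_single single_add[symmetric])

text \<open>Multiplying by \<open>r\<close> acts on the coefficients at the minimal monomials \<open>G\<close> through the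
  constant term of \<open>r\<close> alone. So the coefficient vectors of the members of a generating set
  span \<open>K\<^sup>G\<close>, whence the lower bound.\<close>

lemma num_gens_mon_ideal:
  fixes G :: "('v \<Rightarrow>\<^sub>0 nat) set"
  assumes fin: "finite G" and G: "G \<subseteq> monoms V"
    and anti: "\<And>g h s. g \<in> G \<Longrightarrow> h \<in> G \<Longrightarrow> h = g + s \<Longrightarrow> s = 0"
  shows "num_gens (mpol_ring V) (mon_ideal (G + monoms V) :: ('v, 'k::field) mpol set) = card G"
  unfolding num_gens_def
proof (rule Least_equality)
  let ?R = "mpol_ring V :: ('v, 'k) mpol ring"
  let ?L = "mon_ideal (G + monoms V) :: ('v, 'k) mpol set"
  let ?S = "(\<lambda>t. Poly_Mapping.single t (1::'k)) ` G"
  have inj: "inj_on (\<lambda>t. Poly_Mapping.single t (1::'k)) G"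
    by (rule inj_onI) (metis keys_single one_neq_zero singleton_inject)
  show "\<exists>S. S \<subseteq> carrier ?R \<and> finite S \<and> card S = card G \<and> Idl\<^bsub>?R\<^esub> S = ?L"
    using G fin by (intro exI[of _ ?S])
      (auto simp: card_image[OF inj] Idl_single carrier_mpol_ring single_in_mon_ideal_iff)
  fix n assume "\<exists>S. S \<subseteq> carrier ?R \<and> finite S \<and> card S = n \<and> Idl\<^bsub>?R\<^esub> S = ?L"
  then obtain S where S: "S \<subseteq> carrier ?R" "finite S" "card S = n" "Idl\<^bsub>?R\<^esub> S = ?L" by blast
  interpret cring ?R by (rule mpol_ring_cring)
  interpret vs: vector_space "\<lambda>(c::'k) (f::('v \<Rightarrow>\<^sub>0 nat) \<Rightarrow> 'k) x. c * f x"
    by standard (auto simp: fun_eq_iff algebra_simps)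
  define \<pi> where "\<pi> p = (\<lambda>t. if t \<in> G then Poly_Mapping.lookup p t else 0)"
    for p :: "('v, 'k) mpol"
  define e where "e g = (\<lambda>t. if t = g then 1 else 0 :: 'k)" for g :: "'v \<Rightarrow>\<^sub>0 nat"
  have pi_add: "\<pi> (p + q) = \<pi> p + \<pi> q" for p q
    by (auto simp: \<pi>_def fun_eq_iff lookup_add)
  have pi_mult: "\<pi> (r * p) = (\<lambda>t. Poly_Mapping.lookup r 0 * \<pi> p t)" if p: "p \<in> ?L" for r p
  proof
    fix t show "\<pi> (r * p) t = Poly_Mapping.lookup r 0 * \<pi> p t"
    proof (cases "t \<in> G")
      case True
      \<comment> \<open>A nonzero contribution gives \<open>t = l + q\<close> with \<open>q\<close>
        a multiple of some \<open>g\<close> in \<open>G\<close>. Minimality of \<open>t\<close>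
        makes the cofactor of \<open>g\<close> trivial, so only \<open>l = 0\<close>
        survives.\<close>
      have *: "Poly_Mapping.lookup r l * (\<Sum>q. Poly_Mapping.lookup p q when t = l + q)
          = (Poly_Mapping.lookup r 0 * Poly_Mapping.lookup p t when l = 0)" for l
      proof (cases "l = 0")
        case False
        have "(Poly_Mapping.lookup p q when t = l + q) = 0" for q
        proof (rule ccontr)
          assume "\<not> ?thesis"
          then have q: "q \<in> Poly_Mapping.keys p" "t = l + q"
            by (auto simp: in_keys_iff when_def split: if_splits)
          then obtain g s where "q = g + s" "g \<in> G"
            using p by (auto simp: mon_ideal_def elim!: set_plus_elim dest!: subsetD)
          with q True have "s + l = 0" by (intro anti[of g t]) (auto simp: ac_simps)
          then have "Poly_Mapping.lookup l x = 0" for x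
            by (metis add_is_0 lookup_add lookup_zero)
          with False show False by (auto intro: poly_mapping_eqI)
        qed
        then show ?thesis using False by simp
      qed simp
      show ?thesis using True by (simp add: \<pi>_def lookup_mult *)
    qed (simp add: \<pi>_def)
  qed
  \<comment> \<open>The members of \<open>?L\<close> whose coefficient vectors lie in the span of
    those of \<open>S\<close>. They form an ideal containing \<open>S\<close>, hence are all of
    \<open>?L\<close>.\<close>
  let ?J = "{p \<in> ?L. \<pi> p \<in> vs.span (\<pi> ` S)}"
  have L: "ideal ?L ?R" using S(1,4) genideal_ideal by metis
  interpret L: ideal ?L ?R by (rule L)
  have mulL: "r * p \<in> ?L" if "p \<in> ?L" "r \<in> carrier ?R" for r p
    using L.I_l_closed[OF that] by simp
  have J: "ideal ?J ?R"
  proof (rule idealI)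
    show "ring ?R" by (rule ring_axioms)
    have mul: "r * p \<in> ?J" if "p \<in> ?J" "r \<in> carrier ?R" for r p
      using that mulL by (auto simp: pi_mult intro: vs.span_scale)
    then show "x \<otimes>\<^bsub>?R\<^esub> a \<in> ?J" "a \<otimes>\<^bsub>?R\<^esub> x \<in> ?J" if "a \<in> ?J" "x \<in> carrier ?R" for a x
      using that by (simp_all only: mpol_ring_simps mult.commute[of a])
    show "subgroup ?J (add_monoid ?R)"
    proof (rule group.subgroupI)
      show "group (add_monoid ?R)" by (rule a_group)
      show "?J \<subseteq> carrier (add_monoid ?R)" using additive_subgroup.a_subset[OF ideal.axioms(1)[OF L]] by auto
      have "\<pi> 0 = 0" by (simp add: \<pi>_def fun_eq_iff)
      then have "0 \<in> ?J"
        using additive_subgroup.zero_closed[OF ideal.axioms(1)[OF L]] vs.span_zero by simp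
      then show "?J \<noteq> {}" by blast
      fix p assume p: "p \<in> ?J"
      have m1: "\<ominus>\<^bsub>?R\<^esub> \<one>\<^bsub>?R\<^esub> \<in> carrier ?R" by (rule a_inv_closed[OF one_closed])
      \<comment> \<open>Negation is written as multiplication by -1, so that closure under
        multiplication applies.\<close>
      have "inv\<^bsub>add_monoid ?R\<^esub> p = (\<ominus>\<^bsub>?R\<^esub> \<one>\<^bsub>?R\<^esub>) * p"
        using p additive_subgroup.a_subset[OF ideal.axioms(1)[OF L]] l_minus[OF one_closed, of p] by (auto simp: a_inv_def)
      with mul[OF p m1] show "inv\<^bsub>add_monoid ?R\<^esub> p \<in> ?J" by simp
    qed (use additive_subgroup.a_closed[OF ideal.axioms(1)[OF L]] in \<open>auto simp: pi_add intro: vs.span_add\<close>)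
  qed
  have "S \<subseteq> ?J" using genideal_self[OF S(1)] S(4) by (auto intro: vs.span_base)
  then have LJ: "?L \<subseteq> ?J" using genideal_minimal[OF J] S(4) by blast
  \<comment> \<open>The monomials in \<open>G\<close> belong to \<open>?L\<close>, and their
    coefficient vectors are the unit vectors, which are independent. A set spanning all of them has
    at least \<open>card G\<close> elements.\<close>
  have "e ` G \<subseteq> vs.span (\<pi> ` S)"
  proof
    fix f assume "f \<in> e ` G"
    then obtain g where g: "g \<in> G" "f = e g" by blast
    have "g + 0 \<in> G + monoms V" using g(1) zero_in_monoms by (rule set_plus_intro)
    then have "Poly_Mapping.single g 1 \<in> ?L" by (simp add: single_in_mon_ideal_iff)
    then have "Poly_Mapping.single g 1 \<in> ?J" by (rule subsetD[OF LJ])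
    moreover have "\<pi> (Poly_Mapping.single g 1) = e g"
      using g by (auto simp: \<pi>_def e_def fun_eq_iff lookup_single when_def)
    ultimately show "f \<in> vs.span (\<pi> ` S)" using g by simp
  qed
  moreover have e_inj: "inj_on e G"
    by (rule inj_onI) (metis e_def one_neq_zero)
  moreover have "vs.independent (e ` G)"
  proof (rule vs.independent_if_scalars_zero)
    fix u :: "_ \<Rightarrow> 'k" and f
    assume sum0: "(\<Sum>x\<in>e ` G. (\<lambda>y. u x * x y)) = 0" and "f \<in> e ` G"
    then obtain g where g: "g \<in> G" "f = e g" by blast
    have apply_sum: "sum F H g = (\<Sum>h\<in>H. F h g)"
      for F :: "('v \<Rightarrow>\<^sub>0 nat) \<Rightarrow> ('v \<Rightarrow>\<^sub>0 nat) \<Rightarrow> 'k" and H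
      by (induction H rule: infinite_finite_induct) auto
    have "0 = (\<Sum>x\<in>e ` G. (\<lambda>y. u x * x y)) g" by (simp add: sum0)
    also have "\<dots> = (\<Sum>h\<in>G. u (e h) * e h g)"
      by (simp add: sum.reindex[OF e_inj] apply_sum)
    also have "\<dots> = u (e g)"
      using fin g by (simp add: e_def if_distrib sum.delta cong: if_cong)
    finally show "u f = 0" using g by simp
  qed (use fin in simp)
  ultimately have "card (e ` G) \<le> card (\<pi> ` S)"
    using vs.independent_span_bound[of "\<pi> ` S" "e ` G"] S(2) by simp
  also have "\<dots> \<le> n" using S(2,3) card_image_le by blast
  finally show "card G \<le> n" using e_inj by (simp add: card_image)
qed

section \<open>Monomial ideals in disjoint pairs of variables\<close>

lemma UNIV_plus_UNIV: "(UNIV :: 'a::monoid_add set) + UNIV = UNIV"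
  by (metis UNIV_I UNIV_eq_I add.right_neutral set_plus_intro)

definition pvars :: "nat set \<Rightarrow> xy set" where
  "pvars J = X ` J \<union> Y ` J"

text \<open>One condition for each pair of variables, independent of the other pairs. Ideal
  operations on such sets can then be carried out pair by pair on subsets of the plane.\<close>

definition box :: "nat set \<Rightarrow> (nat \<Rightarrow> (nat \<times> nat) set) \<Rightarrow> (xy \<Rightarrow>\<^sub>0 nat) set" where
  "box J W = {t \<in> monoms (pvars J).
     \<forall>j\<in>J. (Poly_Mapping.lookup t (X j), Poly_Mapping.lookup t (Y j)) \<in> W j}"

text \<open>Assembles a monomial from its exponent pairs. Values of \<open>p\<close> outside
  \<open>J\<close> are ignored, and finiteness of \<open>J\<close> guarantees the finite support
  that \<open>Abs_poly_mapping\<close> requires.\<close>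

definition pmon :: "nat set \<Rightarrow> (nat \<Rightarrow> nat \<times> nat) \<Rightarrow> (xy \<Rightarrow>\<^sub>0 nat)" where
  "pmon J p = Poly_Mapping.Abs_poly_mapping
     (\<lambda>z. case z of X j \<Rightarrow> fst (p j) when j \<in> J | Y j \<Rightarrow> snd (p j) when j \<in> J)"

lemma lookup_pmon:
  assumes "finite J"
  shows "Poly_Mapping.lookup (pmon J p) (X j) = (fst (p j) when j \<in> J)"
    and "Poly_Mapping.lookup (pmon J p) (Y j) = (snd (p j) when j \<in> J)"
proof -
  let ?f = "\<lambda>z. case z of X j \<Rightarrow> fst (p j) when j \<in> J | Y j \<Rightarrow> snd (p j) when j \<in> J"
  have "{z. ?f z \<noteq> 0} \<subseteq> pvars J"
  proof
    fix z assume "z \<in> {z. ?f z \<noteq> 0}"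
    then show "z \<in> pvars J" by (cases z) (auto simp: pvars_def when_def split: if_splits)
  qed
  then have "finite {z. ?f z \<noteq> 0}"
    by (rule finite_subset) (simp add: pvars_def assms)
  then show "Poly_Mapping.lookup (pmon J p) (X j) = (fst (p j) when j \<in> J)"
    "Poly_Mapping.lookup (pmon J p) (Y j) = (snd (p j) when j \<in> J)"
    by (simp_all add: pmon_def)
qed

lemma monoms_pvars_iff:
  "t \<in> monoms (pvars J) \<longleftrightarrow>
    (\<forall>j. j \<notin> J \<longrightarrow> Poly_Mapping.lookup t (X j) = 0 \<and> Poly_Mapping.lookup t (Y j) = 0)"
proof
  assume "t \<in> monoms (pvars J)"
  then show "\<forall>j. j \<notin> J \<longrightarrow> Poly_Mapping.lookup t (X j) = 0 \<and> Poly_Mapping.lookup t (Y j) = 0"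
    by (auto simp: monoms_def pvars_def not_in_keys_iff_lookup_eq_zero[symmetric])
next
  assume *: "\<forall>j. j \<notin> J \<longrightarrow> Poly_Mapping.lookup t (X j) = 0 \<and> Poly_Mapping.lookup t (Y j) = 0"
  have "z \<in> pvars J" if "z \<in> Poly_Mapping.keys t" for z
    using that * by (cases z) (auto simp: in_keys_iff pvars_def)
  then show "t \<in> monoms (pvars J)" by (auto simp: monoms_def)
qed

lemma poly_mapping_xy_eqI:
  assumes "\<And>j. Poly_Mapping.lookup s (X j) = Poly_Mapping.lookup t (X j)"
    and "\<And>j. Poly_Mapping.lookup s (Y j) = Poly_Mapping.lookup t (Y j)"
  shows "s = t"
proof (rule poly_mapping_eqI)
  fix z show "Poly_Mapping.lookup s z = Poly_Mapping.lookup t z"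
    by (cases z) (simp_all add: assms)
qed

lemma pmon_in_box_iff:
  "finite J \<Longrightarrow> pmon J p \<in> box J W \<longleftrightarrow> (\<forall>j\<in>J. p j \<in> W j)"
  by (auto simp: box_def monoms_pvars_iff lookup_pmon)

lemma box_UNIV: "box J (\<lambda>_. UNIV) = monoms (pvars J)"
  by (auto simp: box_def)

lemma box_cong: "(\<And>j. j \<in> J \<Longrightarrow> W j = W' j) \<Longrightarrow> box J W = box J W'"
  by (auto simp: box_def)

lemma box_subset: "box J W \<subseteq> monoms (pvars J)"
  by (auto simp: box_def)

lemma box_Un: "box {j} (\<lambda>_. W) \<union> box {j} (\<lambda>_. W') = box {j} (\<lambda>_. W \<union> W')"
  by (auto simp: box_def)

text \<open>For the harder inclusion, the exponent pairs of a monomial are decomposed separately for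
  each \<open>j\<close>, and the chosen halves are glued together by \<open>pmon\<close>.\<close>

lemma box_plus:
  assumes "finite J"
  shows "box J W + box J W' = box J (\<lambda>j. W j + W' j)"
proof
  show "box J W + box J W' \<subseteq> box J (\<lambda>j. W j + W' j)"
  proof
    fix t assume "t \<in> box J W + box J W'"
    then obtain u w where t: "t = u + w" "u \<in> box J W" "w \<in> box J W'" by (rule set_plus_elim)
    have "(Poly_Mapping.lookup t (X j), Poly_Mapping.lookup t (Y j)) \<in> W j + W' j" if "j \<in> J" for j
      using t that set_plus_intro[of "(Poly_Mapping.lookup u (X j), Poly_Mapping.lookup u (Y j))" "W j"
          "(Poly_Mapping.lookup w (X j), Poly_Mapping.lookup w (Y j))" "W' j"]
      by (simp add: box_def lookup_add)
    moreover have "t \<in> monoms (pvars J)" using t by (auto simp: box_def intro: monoms_add)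
    ultimately show "t \<in> box J (\<lambda>j. W j + W' j)" by (simp add: box_def)
  qed
  show "box J (\<lambda>j. W j + W' j) \<subseteq> box J W + box J W'"
  proof
    fix t assume t: "t \<in> box J (\<lambda>j. W j + W' j)"
    then have "\<forall>j\<in>J. \<exists>a b. a \<in> W j \<and> b \<in> W' j \<and>
        (Poly_Mapping.lookup t (X j), Poly_Mapping.lookup t (Y j)) = a + b"
      by (fastforce simp: box_def elim!: set_plus_elim)
    then obtain a b where ab: "\<And>j. j \<in> J \<Longrightarrow> a j \<in> W j" "\<And>j. j \<in> J \<Longrightarrow> b j \<in> W' j"
      "\<And>j. j \<in> J \<Longrightarrow> (Poly_Mapping.lookup t (X j), Poly_Mapping.lookup t (Y j)) = a j + b j"
      by metis
    have "t = pmon J a + pmon J b"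
    proof (rule poly_mapping_xy_eqI)
      fix j
      show "Poly_Mapping.lookup t (X j) = Poly_Mapping.lookup (pmon J a + pmon J b) (X j)"
        using ab(3)[of j] t
        by (cases "j \<in> J") (auto simp: lookup_add lookup_pmon assms box_def monoms_pvars_iff plus_prod_def)
      show "Poly_Mapping.lookup t (Y j) = Poly_Mapping.lookup (pmon J a + pmon J b) (Y j)"
        using ab(3)[of j] t
        by (cases "j \<in> J") (auto simp: lookup_add lookup_pmon assms box_def monoms_pvars_iff plus_prod_def)
    qed
    then show "t \<in> box J W + box J W'"
      using ab assms by (auto simp: pmon_in_box_iff intro!: set_plus_intro)
  qed
qed

lemma box_plus_monoms:
  assumes "finite J" "\<And>j. j \<in> J \<Longrightarrow> W j + UNIV = W j"
  shows "box J W + monoms (pvars J) = box J W"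
  unfolding box_UNIV[symmetric] box_plus[OF assms(1)] by (rule box_cong) (simp add: assms)

text \<open>Describes the extension of an ideal in the variables of index \<open>j\<close> to the
  larger ring: the other pairs of variables become unrestricted, which \<open>UNIV\<close>
  expresses.\<close>

lemma box_single_plus_monoms:
  assumes J: "finite J" "j \<in> J" and W: "W + UNIV = W"
  shows "box {j} (\<lambda>_. W) + monoms (pvars J) = box J (\<lambda>i. if i = j then W else UNIV)"
proof -
  have "box {j} (\<lambda>_. W) \<subseteq> box J (\<lambda>i. if i = j then W else UNIV)"
    using J by (auto simp: box_def monoms_pvars_iff)
  then have "box {j} (\<lambda>_. W) + monoms (pvars J) \<subseteq>
      box J (\<lambda>i. if i = j then W else UNIV) + monoms (pvars J)"
    by (intro set_plus_mono2) auto
  also have "\<dots> = box J (\<lambda>i. if i = j then W else UNIV)"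
    using W by (intro box_plus_monoms J) (auto simp: UNIV_plus_UNIV)
  finally have 1: "box {j} (\<lambda>_. W) + monoms (pvars J) \<subseteq> box J (\<lambda>i. if i = j then W else UNIV)" .
  have "box J (\<lambda>i. if i = j then W else UNIV) \<subseteq> box {j} (\<lambda>_. W) + monoms (pvars J)"
  proof
    fix t assume t: "t \<in> box J (\<lambda>i. if i = j then W else UNIV)"
    let ?p = "\<lambda>i. (Poly_Mapping.lookup t (X i), Poly_Mapping.lookup t (Y i))"
    have "pmon {j} ?p \<in> box {j} (\<lambda>_. W)"
      using t J by (subst pmon_in_box_iff) (auto simp: box_def split: if_splits)
    moreover have "pmon (J - {j}) ?p \<in> monoms (pvars J)"
      using J by (auto simp: monoms_pvars_iff lookup_pmon)
    moreover have "t = pmon {j} ?p + pmon (J - {j}) ?p"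
      by (rule poly_mapping_xy_eqI)
        (use t J in \<open>auto simp: lookup_add lookup_pmon when_def box_def monoms_pvars_iff\<close>)
    ultimately show "t \<in> box {j} (\<lambda>_. W) + monoms (pvars J)"
      by (rule set_plus_memI)
  qed
  with 1 show ?thesis by (rule antisym)
qed

section \<open>Products, powers and generator numbers of box ideals\<close>

lemma ideal_box:
  assumes "finite J" "\<And>j. j \<in> J \<Longrightarrow> W j + UNIV = W j"
  shows "ideal (mon_ideal (box J W)) (mpol_ring (pvars J))"
  by (rule ideal_mon_ideal) (simp_all add: box_subset box_plus_monoms assms)

lemma ideal_prod_box:
  assumes "finite J" "\<And>j. j \<in> J \<Longrightarrow> W j + UNIV = W j" "\<And>j. j \<in> J \<Longrightarrow> W' j + UNIV = W' j"
  shows "mon_ideal (box J W) \<cdot>\<^bsub>mpol_ring (pvars J)\<^esub> mon_ideal (box J W') =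
    mon_ideal (box J (\<lambda>j. W j + W' j))"
  by (subst ideal_prod_mon_ideal) (simp_all add: box_subset box_plus_monoms box_plus assms)

lemma ideals_set_simps:
  "I \<otimes>\<^bsub>ideals_set R\<^esub> J = I \<cdot>\<^bsub>R\<^esub> J" "\<one>\<^bsub>ideals_set R\<^esub> = carrier R"
  "carrier (ideals_set R) = {I. ideal I R}"
  by (simp_all add: ideals_set_def)

text \<open>The sets \<open>D j k\<close> are characterised by recursion rather than constructed, so
  that a closed form for the powers can be plugged in. The start value \<open>UNIV\<close> reflects
  that the zeroth power is the unit ideal.\<close>

lemma pow_box:
  assumes "finite J"
    and W: "\<And>j. j \<in> J \<Longrightarrow> W j + UNIV = W j"
    and D: "\<And>j. j \<in> J \<Longrightarrow> D j 0 = UNIV" "\<And>j k. j \<in> J \<Longrightarrow> D j (Suc k) = D j k + W j"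
  shows "mon_ideal (box J W) [^]\<^bsub>ideals_set (mpol_ring (pvars J))\<^esub> (k::nat) =
    mon_ideal (box J (\<lambda>j. D j k))"
proof (induction k)
  case 0
  show ?case
    using box_cong[of J "\<lambda>j. D j 0" "\<lambda>_. UNIV"] D(1)
    by (simp add: ideals_set_simps carrier_mpol_ring box_UNIV)
next
  case (Suc k)
  have up: "D j k + UNIV = D j k" if "j \<in> J" for j
  proof (cases k)
    case 0
    then show ?thesis using D(1)[OF that] by (simp add: UNIV_plus_UNIV)
  next
    case (Suc n)
    then show ?thesis using D(2)[OF that] W[OF that] by (simp add: add.assoc)
  qed
  show ?case
    using box_cong[of J "\<lambda>j. D j (Suc k)" "\<lambda>j. D j k + W j"]
    by (simp add: ideals_set_simps Suc.IH ideal_prod_box assms up)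
qed

lemma finprod_box:
  assumes J: "finite J" "F \<subseteq> J" and W: "\<And>j. j \<in> J \<Longrightarrow> W j + UNIV = W j"
    and I: "\<And>j. j \<in> F \<Longrightarrow> I j = mon_ideal (box J (\<lambda>i. if i = j then W j else UNIV))"
  shows "(\<Otimes>\<^bsub>ideals_set (mpol_ring (pvars J) :: (xy, 'k::field) mpol ring)\<^esub>j\<in>F. I j) =
    mon_ideal (box J (\<lambda>i. if i \<in> F then W i else UNIV))"
proof -
  let ?R = "mpol_ring (pvars J) :: (xy, 'k::field) mpol ring"
  interpret cring ?R by (rule mpol_ring_cring)
  interpret S: comm_monoid "ideals_set ?R" by (rule ideals_set_is_comm_monoid)
  have ideal: "ideal (mon_ideal (box J (\<lambda>i. if i = j then W j else UNIV))) ?R" for j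
    by (rule ideal_box) (use J W UNIV_plus_UNIV in auto)
  have "finite F" using J finite_subset by blast
  then show ?thesis using J(2) I
  proof (induction F)
    case empty
    show ?case using box_UNIV[of J] by (simp add: ideals_set_simps carrier_mpol_ring)
  next
    case (insert j F)
    have "(\<Otimes>\<^bsub>ideals_set ?R\<^esub>j\<in>insert j F. I j) = I j \<cdot>\<^bsub>?R\<^esub> (\<Otimes>\<^bsub>ideals_set ?R\<^esub>j\<in>F. I j)"
      by (subst S.finprod_insert) (use insert ideal in \<open>auto simp: ideals_set_simps\<close>)
    also have "\<dots> = mon_ideal (box J (\<lambda>i. if i = j then W j else UNIV)) \<cdot>\<^bsub>?R\<^esub>
        mon_ideal (box J (\<lambda>i. if i \<in> F then W i else UNIV))"
      using insert by simp
    also have "\<dots> = mon_ideal (box J (\<lambda>i. (if i = j then W j else UNIV) + (if i \<in> F then W i else UNIV)))"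
      by (rule ideal_prod_box) (use J W UNIV_plus_UNIV insert.prems(1) in auto)
    also have "box J (\<lambda>i. (if i = j then W j else UNIV) + (if i \<in> F then W i else UNIV)) =
        box J (\<lambda>i. if i \<in> insert j F then W i else UNIV)"
    proof (rule box_cong)
      fix i assume "i \<in> J"
      \<comment> \<open>For upward closed sets \<open>UNIV\<close> is neutral under addition, so at
        each index only the factor that restricts it matters.\<close>
      then have "UNIV + W i = W i" using W by (metis add.commute)
      with W[OF \<open>i \<in> J\<close>] show "(if i = j then W j else UNIV) + (if i \<in> F then W i else UNIV) =
          (if i \<in> insert j F then W i else UNIV)"
        using insert.hyps(2) by (auto simp: UNIV_plus_UNIV)
    qed
    finally show ?case .
  qed
qed

text \<open>A minimal generator is obtained by choosing one minimal exponent pair for each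
  \<open>j\<close>, that is, an element of \<open>Pi\<^sub>E J G\<close>. Divisibility is tested
  pair by pair, so these monomials again form an antichain, and their number is a product.\<close>

lemma num_gens_box:
  assumes J: "finite J"
    and fin: "\<And>j. j \<in> J \<Longrightarrow> finite (G j)"
    and anti: "\<And>j g h s. j \<in> J \<Longrightarrow> g \<in> G j \<Longrightarrow> h \<in> G j \<Longrightarrow> h = g + s \<Longrightarrow> s = 0"
  shows "num_gens (mpol_ring (pvars J))
    (mon_ideal (box J (\<lambda>j. G j + UNIV)) :: (xy, 'k::field) mpol set) = (\<Prod>j\<in>J. card (G j))"
proof -
  have gens: "pmon J ` Pi\<^sub>E J G = box J G"
  proof
    show "pmon J ` Pi\<^sub>E J G \<subseteq> box J G" by (auto simp: pmon_in_box_iff J)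
    show "box J G \<subseteq> pmon J ` Pi\<^sub>E J G"
    proof
      fix t assume t: "t \<in> box J G"
      let ?p = "restrict (\<lambda>i. (Poly_Mapping.lookup t (X i), Poly_Mapping.lookup t (Y i))) J"
      have "t = pmon J ?p"
        by (rule poly_mapping_xy_eqI)
          (use t J in \<open>auto simp: lookup_pmon when_def box_def monoms_pvars_iff\<close>)
      moreover have "?p \<in> Pi\<^sub>E J G" using t by (auto simp: box_def)
      ultimately show "t \<in> pmon J ` Pi\<^sub>E J G" by blast
    qed
  qed
  have inj: "inj_on (pmon J) (Pi\<^sub>E J G)"
  proof (rule inj_onI)
    fix p p' assume p: "p \<in> Pi\<^sub>E J G" "p' \<in> Pi\<^sub>E J G" and eq: "pmon J p = pmon J p'"
    show "p = p'"
    proof (rule PiE_ext[OF p])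
      fix j assume "j \<in> J"
      then show "p j = p' j"
        using lookup_pmon[OF J, of p j] lookup_pmon[OF J, of p' j] eq by (simp add: prod_eq_iff)
    qed
  qed
  have "num_gens (mpol_ring (pvars J)) (mon_ideal (box J G + monoms (pvars J)) :: (xy, 'k) mpol set)
      = card (box J G)"
  proof (rule num_gens_mon_ideal)
    show "finite (box J G)" unfolding gens[symmetric] by (intro finite_imageI finite_PiE J fin)
    fix g h s assume gh: "g \<in> box J G" "h \<in> box J G" "h = g + s"
    have *: "Poly_Mapping.lookup s (X j) = 0 \<and> Poly_Mapping.lookup s (Y j) = 0" for j
    proof (cases "j \<in> J")
      case True
      then show ?thesis
        using gh anti[OF True, of "(Poly_Mapping.lookup g (X j), Poly_Mapping.lookup g (Y j))"
            "(Poly_Mapping.lookup h (X j), Poly_Mapping.lookup h (Y j))"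
            "(Poly_Mapping.lookup s (X j), Poly_Mapping.lookup s (Y j))"]
        by (auto simp: box_def lookup_add zero_prod_def)
    next
      case False
      then show ?thesis using gh by (auto simp: box_def monoms_pvars_iff lookup_add)
    qed
    show "s = 0" by (rule poly_mapping_xy_eqI) (simp_all add: *)
  qed (rule box_subset)
  also have "card (box J G) = (\<Prod>j\<in>J. card (G j))"
    unfolding gens[symmetric] by (simp add: card_image[OF inj] card_PiE J)
  finally show ?thesis by (simp add: box_UNIV[symmetric] box_plus J)
qed

lemma Idl_var_powers:
  "Idl\<^bsub>mpol_ring (pvars {j})\<^esub> {var (X j) ^ n, var (Y j) ^ n :: (xy, 'k::field) mpol} =
    mon_ideal (box {j} (\<lambda>_. {(u, v). n \<le> u \<or> n \<le> v}))"
proof -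
  let ?G = "{Poly_Mapping.single (X j) n, Poly_Mapping.single (Y j) n}"
  have G: "?G = pmon {j} ` {\<lambda>_. (n, 0), \<lambda>_. (0, n)}"
  proof -
    have "Poly_Mapping.single (X j) n = pmon {j} (\<lambda>_. (n, 0))"
      by (rule poly_mapping_xy_eqI) (auto simp: lookup_pmon lookup_single when_def)
    moreover have "Poly_Mapping.single (Y j) n = pmon {j} (\<lambda>_. (0, n))"
      by (rule poly_mapping_xy_eqI) (auto simp: lookup_pmon lookup_single when_def)
    ultimately show ?thesis by simp
  qed
  have "?G = box {j} (\<lambda>_. {(n, 0), (0, n)})"
  proof
    show "?G \<subseteq> box {j} (\<lambda>_. {(n, 0), (0, n)})" unfolding G by (auto simp: pmon_in_box_iff)
    show "box {j} (\<lambda>_. {(n, 0), (0, n)}) \<subseteq> ?G"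
    proof
      fix t assume t: "t \<in> box {j} (\<lambda>_. {(n, 0), (0, n)})"
      have "t = pmon {j} (\<lambda>_. (Poly_Mapping.lookup t (X j), Poly_Mapping.lookup t (Y j)))"
        by (rule poly_mapping_xy_eqI) (use t in \<open>auto simp: lookup_pmon when_def box_def monoms_pvars_iff\<close>)
      with t show "t \<in> ?G" unfolding G by (auto simp: box_def)
    qed
  qed
  then have "?G + monoms (pvars {j}) = box {j} (\<lambda>_. {(n, 0), (0, n)} + UNIV)"
    by (simp add: box_plus box_UNIV[symmetric])
  also have "{(n, 0), (0, n)} + UNIV = {(u, v). n \<le> u \<or> n \<le> v}"
    by (auto simp: set_plus_def plus_prod_def le_iff_add)
  finally have *: "?G + monoms (pvars {j}) = box {j} (\<lambda>_. {(u, v). n \<le> u \<or> n \<le> v})" .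
  have "?G \<subseteq> monoms (pvars {j})" by (auto simp: monoms_def pvars_def)
  from Idl_single[OF this, where 'k = 'k] show ?thesis
    by (simp add: var_power *)
qed

section \<open>Powers of a single factor\<close>

text \<open>After dividing by \<open>m\<close>, the x-exponents of the products of \<open>k\<close> of the four generators
  of degree \<open>(A + 1) m\<close>, namely \<open>x\<^bsup>Am\<^esup>x\<^bsup>m\<^esup>\<close>, \<open>x\<^bsup>Am\<^esup>y\<^bsup>m\<^esup>\<close>, \<open>y\<^bsup>Am\<^esup>x\<^bsup>m\<^esup>\<close> and \<open>y\<^bsup>Am\<^esup>y\<^bsup>m\<^esup>\<close>.\<close>

definition expos :: "nat \<Rightarrow> nat \<Rightarrow> nat set" where
  "expos A k = {A * i + j | i j. i \<le> k \<and> j \<le> k}"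

text \<open>The exponent pairs of the monomials in the \<open>k\<close>-th power of the ideal with parameters
  \<open>A\<close>, \<open>m\<close>. The second alternative says that the degree is at least \<open>(A + 1) m k + m - 1\<close>.\<close>

definition ppow :: "nat \<Rightarrow> nat \<Rightarrow> nat \<Rightarrow> (nat \<times> nat) set" where
  "ppow A m k = {(u, v). (\<exists>e\<in>expos A k. m * e \<le> u \<and> m * ((A + 1) * k - e) \<le> v)
     \<or> m * ((A + 1) * k + 1) \<le> u + v + 1}"

text \<open>The minimal elements of \<open>ppow A m k\<close>. A monomial of degree \<open>(A + 1) m k + m - 1\<close> is a
  multiple of a generator of lower degree iff the quotient of its x-exponent by \<open>m\<close> lies in
  \<open>expos A k\<close>.\<close>

definition pgens :: "nat \<Rightarrow> nat \<Rightarrow> nat \<Rightarrow> (nat \<times> nat) set" where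
  "pgens A m k = (\<lambda>e. (m * e, m * ((A + 1) * k - e))) ` expos A k \<union>
     (\<lambda>(e, r). (m * e + r, m * ((A + 1) * k - e) + (m - 1 - r))) `
       (({..(A + 1) * k} - expos A k) \<times> {..<m})"

lemma exposI: "i \<le> k \<Longrightarrow> j \<le> k \<Longrightarrow> A * i + j \<in> expos A k"
  by (auto simp: expos_def)

lemma expos_le: "e \<in> expos A k \<Longrightarrow> e \<le> (A + 1) * k"
proof -
  assume "e \<in> expos A k"
  then obtain i j where e: "e = A * i + j" "i \<le> k" "j \<le> k" by (auto simp: expos_def)
  have "A * i + j \<le> A * k + k" using e(2,3) by (intro add_mono) auto
  then show ?thesis by (simp add: e(1))
qed

lemma mult_split_nat: "e \<le> N \<Longrightarrow> m * e + m * (N - e) = m * (N :: nat)"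
  by (metis distrib_left le_add_diff_inverse)

lemma finite_expos: "finite (expos A k)"
  by (rule finite_subset[of _ "{..(A + 1) * k}"]) (auto dest: expos_le)

lemma expos_0: "expos A 0 = {0}"
  by (auto simp: expos_def)

lemma expos_add:
  assumes "e \<in> expos A k" "f \<in> expos A n"
  shows "e + f \<in> expos A (k + n)"
proof -
  obtain i j i' j' where "e = A * i + j" "i \<le> k" "j \<le> k" "f = A * i' + j'" "i' \<le> n" "j' \<le> n"
    using assms by (auto simp: expos_def)
  then show ?thesis
    using exposI[of "i + i'" "k + n" "j + j'" A] by (simp add: algebra_simps)
qed

text \<open>Cut both \<open>i\<close> and \<open>j\<close> at \<open>k\<close>; each excess is at
  most 1 and goes into the second summand.\<close>

lemma expos_SucE:
  assumes "e \<in> expos A (Suc k)"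
  obtains f g where "f \<in> expos A k" "g \<in> expos A 1" "e = f + g"
proof -
  obtain i j where e: "e = A * i + j" "i \<le> Suc k" "j \<le> Suc k"
    using assms by (auto simp: expos_def)
  have ij: "i = min i k + (i - min i k)" "j = min j k + (j - min j k)" by simp_all
  have "A * min i k + min j k \<in> expos A k" by (rule exposI) simp_all
  moreover have "A * (i - min i k) + (j - min j k) \<in> expos A 1"
    by (rule exposI) (use e in auto)
  moreover have "e = A * min i k + min j k + (A * (i - min i k) + (j - min j k))"
    unfolding e(1) by (subst ij(1), subst ij(2)) (simp only: distrib_left ac_simps)
  ultimately show ?thesis using that by blast
qed

text \<open>Consecutive members of \<open>expos A k\<close> are at most \<open>A\<close> apart.\<close>

lemma expos_near:
  assumes "A \<ge> 1"
  obtains e where "e \<in> expos A k" "e \<le> q" "e = (A + 1) * k \<or> q < e + A"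
proof (cases "q div A < k")
  case True
  \<comment> \<open>Round \<open>q\<close> down to a multiple of \<open>A\<close>.\<close>
  show ?thesis
  proof (rule that[of "A * (q div A) + 0"])
    show "A * (q div A) + 0 \<in> expos A k" using True by (intro exposI) simp_all
    have "q mod A < A" using assms by simp
    then show "A * (q div A) + 0 = (A + 1) * k \<or> q < A * (q div A) + 0 + A"
      using mult_div_mod_eq[of A q] by linarith
  qed simp
next
  case False
  then have "A * k \<le> q" 
    using assms by (simp add: less_eq_div_iff_mult_less_eq mult.commute not_less)
  \<comment> \<open>All numbers from \<open>A * k\<close> to \<open>(A + 1) * k\<close> lie in
    \<open>expos A k\<close>, so the witness is \<open>q\<close> itself or the maximal
    element.\<close>
  show ?thesis
  proof (rule that[of "A * k + min k (q - A * k)"])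
    show "A * k + min k (q - A * k) \<in> expos A k" by (rule exposI) simp_all
    show "A * k + min k (q - A * k) \<le> q" using \<open>A * k \<le> q\<close> by simp
    show "A * k + min k (q - A * k) = (A + 1) * k \<or> q < A * k + min k (q - A * k) + A"
      using \<open>A * k \<le> q\<close> assms by (auto simp: min_def)
  qed
qed

lemma ppow_up: "ppow A m k + UNIV = ppow A m k"
proof
  show "ppow A m k + UNIV \<subseteq> ppow A m k"
  proof
    fix w assume "w \<in> ppow A m k + UNIV"
    then obtain u v u' v' where w: "w = (u + u', v + v')" and "(u, v) \<in> ppow A m k"
      by (auto simp: set_plus_def plus_prod_def)
    then consider e where "e \<in> expos A k" "m * e \<le> u" "m * ((A + 1) * k - e) \<le> v"
      | "m * ((A + 1) * k + 1) \<le> u + v + 1"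
      by (auto simp: ppow_def)
    then show "w \<in> ppow A m k"
    proof cases
      case 1
      then have "m * e \<le> u + u'" "m * ((A + 1) * k - e) \<le> v + v'" by linarith+
      with 1(1) show ?thesis unfolding w ppow_def by blast
    next
      case 2
      then have "m * ((A + 1) * k + 1) \<le> u + u' + (v + v') + 1" by linarith
      then show ?thesis unfolding w ppow_def by blast
    qed
  qed
  show "ppow A m k \<subseteq> ppow A m k + UNIV"
    by (metis UNIV_I add.right_neutral set_plus_intro subsetI)
qed

lemma ppow_0: "ppow A m 0 = UNIV"
  by (auto simp: ppow_def expos_0)

text \<open>This is the recursion behind the closed form of the powers: multiplying once more by the
  ideal leads from the exponent set for \<open>k\<close> to the one for
  \<open>k + 1\<close>.\<close>

lemma ppow_Suc:
  assumes "A \<ge> 1" "m \<ge> 1"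
  shows "ppow A m (Suc k) = ppow A m k + ppow A m 1"
proof
  let ?N = "(A + 1) * k"
  show "ppow A m (Suc k) \<subseteq> ppow A m k + ppow A m 1"
  proof
    fix w assume "w \<in> ppow A m (Suc k)"
    moreover obtain u v where w: "w = (u, v)" by (cases w)
    ultimately consider e where "e \<in> expos A (Suc k)" "m * e \<le> u" "m * ((A + 1) * Suc k - e) \<le> v"
      | "m * ((A + 1) * Suc k + 1) \<le> u + v + 1"
      by (auto simp: ppow_def)
    then show "w \<in> ppow A m k + ppow A m 1"
    proof cases
      case 1
      obtain f g where fg: "f \<in> expos A k" "g \<in> expos A 1" "e = f + g"
        using 1(1) by (rule expos_SucE)
      have le: "f \<le> ?N" "g \<le> A + 1" using fg expos_le[of f A k] expos_le[of g A 1] by auto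
      have "m * f \<le> u" using 1(2) fg(3) by (auto simp: algebra_simps)
      have "m * g \<le> u - m * f" using 1(2) fg(3) by (auto simp: algebra_simps)
      have "(A + 1) * Suc k - e = (?N - f) + ((A + 1) * 1 - g)"
        using le fg(3) by (simp add: algebra_simps)
      then have v: "m * (?N - f) + m * ((A + 1) * 1 - g) \<le> v"
        using 1(3) by (simp add: distrib_left)
      have "(m * f, m * (?N - f)) \<in> ppow A m k" using fg by (auto simp: ppow_def)
      moreover have "(u - m * f, v - m * (?N - f)) \<in> ppow A m 1"
        using fg(2) \<open>m * g \<le> u - m * f\<close> v by (auto simp: ppow_def)
      moreover have "w = (m * f, m * (?N - f)) + (u - m * f, v - m * (?N - f))"
        using \<open>m * f \<le> u\<close> v by (simp add: w plus_prod_def)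
      ultimately show ?thesis by (rule set_plus_memI)
    next
      case 2
      \<comment> \<open>For a monomial of high degree, divide by the product of \<open>k\<close>
        generators whose x-exponent is closest below \<open>u\<close>. Since the gap is bounded by
        \<open>A\<close>, the y-exponent suffices for this, and the quotient still has the high
        degree required for \<open>k = 1\<close>.\<close>
      obtain e where e: "e \<in> expos A k" "e \<le> u div m" "e = ?N \<or> u div m < e + A"
        using expos_near[OF assms(1)] by metis
      have "m * e \<le> m * (u div m)" using e(2) by simp
      also have "\<dots> \<le> u" by simp
      finally have u: "m * e \<le> u" .
      have leN: "e \<le> ?N" using e(1) by (rule expos_le)
      have v: "m * (?N - e) \<le> v" using e(3)
      proof
        assume "u div m < e + A"
        then have "u < m * (e + A)"
          using assms(2) 
          by (simp add: div_less_iff_less_mult mult.commute)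
        moreover have "m * (?N - e) + m * e = m * ?N"
          using mult_split_nat[OF leN, of m] by simp
        moreover have "m * (e + A) = m * e + m * A" by (simp add: distrib_left)
        moreover have "m * ((A + 1) * Suc k + 1) = m * ?N + m * A + 2 * m" by (simp add: algebra_simps)
        ultimately show ?thesis using 2 assms(2) by linarith
      qed simp
      have "(m * e, m * (?N - e)) \<in> ppow A m k" using e by (auto simp: ppow_def)
      moreover have "(u - m * e, v - m * (?N - e)) \<in> ppow A m 1"
      proof -
        have "m * e + m * (?N - e) = m * ?N" using mult_split_nat[OF leN, of m] by simp
        moreover have "m * ((A + 1) * Suc k + 1) = m * ?N + m * ((A + 1) * 1 + 1)" by (simp add: algebra_simps)
        ultimately have "m * ((A + 1) * 1 + 1) \<le> (u - m * e) + (v - m * (?N - e)) + 1"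
          using 2 u v by linarith
        then show ?thesis by (simp add: ppow_def)
      qed
      moreover have "w = (m * e, m * (?N - e)) + (u - m * e, v - m * (?N - e))"
        using u v by (simp add: w plus_prod_def)
      ultimately show ?thesis by (rule set_plus_memI)
    qed
  qed
  show "ppow A m k + ppow A m 1 \<subseteq> ppow A m (Suc k)"
  proof
    fix w assume "w \<in> ppow A m k + ppow A m 1"
    then obtain u v u' v' where w: "w = (u + u', v + v')"
      and a: "(u, v) \<in> ppow A m k" and b: "(u', v') \<in> ppow A m 1"
      by (auto simp: set_plus_def plus_prod_def)
    \<comment> \<open>If one of the two monomials has high degree, this bound on the other supplies
      the remaining degree of the product.\<close>
    have deg: "m * ((A + 1) * n) \<le> x + y" if "(x, y) \<in> ppow A m n" for x y n
    proof -
      from that consider e where "e \<in> expos A n" "m * e \<le> x" "m * ((A + 1) * n - e) \<le> y"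
        | "m * ((A + 1) * n + 1) \<le> x + y + 1" by (auto simp: ppow_def)
      then show ?thesis
      proof cases
        case 1
        have "m * ((A + 1) * n) = m * e + m * ((A + 1) * n - e)"
          using mult_split_nat[OF expos_le[OF 1(1)], of m] by simp
        with 1 show ?thesis by linarith
      next
        case 2
        have "m * ((A + 1) * n + 1) = m * ((A + 1) * n) + m" by simp
        with 2 assms(2) show ?thesis by linarith
      qed
    qed
    have split1: "m * ((A + 1) * Suc k) = m * ?N + m * ((A + 1) * 1)"
      by (simp add: algebra_simps)
    have split2: "m * (n + 1) = m * n + m" for n
      by simp
    show "w \<in> ppow A m (Suc k)"
    proof (cases "m * ((A + 1) * k + 1) \<le> u + v + 1 \<or> m * ((A + 1) * 1 + 1) \<le> u' + v' + 1")
      case True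
      then have "m * ((A + 1) * Suc k + 1) \<le> u + u' + (v + v') + 1"
        using deg[OF a] deg[OF b] split1 unfolding split2 by linarith
      then show ?thesis unfolding w ppow_def by blast
    next
      case False
      then obtain e f where e: "e \<in> expos A k" "m * e \<le> u" "m * (?N - e) \<le> v"
        and f: "f \<in> expos A 1" "m * f \<le> u'" "m * ((A + 1) * 1 - f) \<le> v'"
        using a b by (auto simp: ppow_def)
      have "(A + 1) * Suc k - (e + f) = (?N - e) + ((A + 1) * 1 - f)"
        using expos_le[OF e(1)] expos_le[OF f(1)] by (simp add: algebra_simps)
      then have "m * ((A + 1) * Suc k - (e + f)) \<le> v + v'"
        using e f by (simp only: distrib_left)
      moreover have "m * (e + f) \<le> u + u'" using e f by (simp add: distrib_left)
      moreover have "e + f \<in> expos A (Suc k)" using expos_add[OF e(1) f(1)] by simp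
      ultimately show ?thesis unfolding w ppow_def by blast
    qed
  qed
qed

lemma pgens_plus:
  assumes "m \<ge> 1"
  shows "pgens A m k + UNIV = ppow A m k"
proof
  let ?N = "(A + 1) * k"
  have "pgens A m k \<subseteq> ppow A m k"
  proof
    fix w assume "w \<in> pgens A m k"
    then consider e where "e \<in> expos A k" "w = (m * e, m * (?N - e))"
      | e r where "e \<le> ?N" "r < m" "w = (m * e + r, m * (?N - e) + (m - 1 - r))"
      by (auto simp: pgens_def)
    then show "w \<in> ppow A m k"
    proof cases
      case 2
      have "m * e + m * (?N - e) = m * ?N" using mult_split_nat[OF 2(1), of m] by simp
      then have "m * (?N + 1) \<le> m * e + r + (m * (?N - e) + (m - 1 - r)) + 1" using 2(2) by simp
      then show ?thesis by (simp add: 2(3) ppow_def)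
    qed (auto simp: ppow_def)
  qed
  then have "pgens A m k + UNIV \<subseteq> ppow A m k + UNIV" by (intro set_plus_mono2) auto
  then show "pgens A m k + UNIV \<subseteq> ppow A m k" by (simp add: ppow_up)
  show "ppow A m k \<subseteq> pgens A m k + UNIV"
  proof
    fix w assume "w \<in> ppow A m k"
    moreover obtain u v where w: "w = (u, v)" by (cases w)
    ultimately have *: "(\<exists>e\<in>expos A k. m * e \<le> u \<and> m * (?N - e) \<le> v) \<or> m * (?N + 1) \<le> u + v + 1"
      by (simp add: ppow_def)
    have "\<exists>a b. (a, b) \<in> pgens A m k \<and> a \<le> u \<and> b \<le> v"
    proof (cases "\<exists>e\<in>expos A k. m * e \<le> u \<and> m * (?N - e) \<le> v")
      case True
      then show ?thesis by (auto simp: pgens_def)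
    next
      case False
      with * have deg: "m * (?N + 1) \<le> u + v + 1" by blast
      \<comment> \<open>Truncating \<open>u\<close> makes room for a divisor of degree exactly
        \<open>m * ?N + m - 1\<close> with x-exponent \<open>u'\<close>. The quotient
        \<open>e\<close> of \<open>u'\<close> by \<open>m\<close> is then at most
        \<open>?N\<close>.\<close>
      define u' where "u' = min u (m * ?N + (m - 1))"
      define e where "e = u' div m"
      define r where "r = u' mod m"
      have u': "u' = m * e + r" by (simp add: e_def r_def)
      have r: "r < m" using assms by (simp add: r_def)
      have "m * e < m * (?N + 1)" using u' assms u'_def by (simp add: algebra_simps)
      then have e: "e \<le> ?N" unfolding mult_less_cancel1 by simp
      have spl: "m * (?N - e) + m * e = m * ?N" using mult_split_nat[OF e, of m] by simp
      have le: "m * e + r \<le> u" using u' u'_def by simp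
      have v: "m * (?N - e) + (m - 1 - r) \<le> v"
        using deg spl u' u'_def r by (cases "u \<le> m * ?N + (m - 1)") auto
      \<comment> \<open>Otherwise a generator of lower degree would divide \<open>w\<close>, against
        the case assumption.\<close>
      have "e \<notin> expos A k"
      proof
        assume "e \<in> expos A k"
        moreover have "m * e \<le> u" "m * (?N - e) \<le> v" using le v by linarith+
        ultimately show False using False by blast
      qed
      then have "(m * e + r, m * (?N - e) + (m - 1 - r)) \<in> pgens A m k"
        using e r by (force simp: pgens_def)
      with le v show ?thesis by blast
    qed
    then obtain a b where ab: "(a, b) \<in> pgens A m k" "a \<le> u" "b \<le> v" by blast
    then have "w = (a, b) + (u - a, v - b)" by (simp add: w plus_prod_def)
    with ab(1) UNIV_I show "w \<in> pgens A m k + UNIV" by (rule set_plus_memI)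
  qed
qed

text \<open>Both exponents are read off modulo \<open>m\<close>: comparing quotients gives
  \<open>e \<le> f\<close> from the x-exponents and \<open>f \<le> e\<close> from the y-exponents.
  With equal quotients both elements are of the same type and have the same degree, so they
  coincide.\<close>

lemma pgens_antichain:
  assumes m: "m \<ge> 1" and g: "g \<in> pgens A m k" and h: "h \<in> pgens A m k" and "h = g + s"
  shows "s = 0"
proof -
  let ?N = "(A + 1) * k"
  have rep: "\<exists>e r d. w = (m * e + r, m * (?N - e) + d) \<and> e \<le> ?N \<and> r < m \<and> d < m \<and>
      (e \<in> expos A k \<and> r = 0 \<and> d = 0 \<or> e \<notin> expos A k \<and> r + d = m - 1)" if "w \<in> pgens A m k" for w
  proof -
    from that consider e where "e \<in> expos A k" "w = (m * e, m * (?N - e))"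
      | e r where "e \<le> ?N" "e \<notin> expos A k" "r < m" "w = (m * e + r, m * (?N - e) + (m - 1 - r))"
      by (auto simp: pgens_def)
    then show ?thesis
    proof cases
      case 1
      then show ?thesis
        using m expos_le[OF 1(1)] by (intro exI[of _ e] exI[of _ 0]) simp
    next
      case 2
      then show ?thesis
        by (intro exI[of _ e] exI[of _ r] exI[of _ "m - 1 - r"]) simp
    qed
  qed
  obtain e r d where e: "g = (m * e + r, m * (?N - e) + d)" "e \<le> ?N" "r < m" "d < m"
    "e \<in> expos A k \<and> r = 0 \<and> d = 0 \<or> e \<notin> expos A k \<and> r + d = m - 1" using rep[OF g] by blast
  obtain f r' d' where f: "h = (m * f + r', m * (?N - f) + d')" "f \<le> ?N" "r' < m" "d' < m"
    "f \<in> expos A k \<and> r' = 0 \<and> d' = 0 \<or> f \<notin> expos A k \<and> r' + d' = m - 1" using rep[OF h] by blast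
  have le: "m * e + r \<le> m * f + r'" "m * (?N - e) + d \<le> m * (?N - f) + d'"
    using \<open>h = g + s\<close> e(1) f(1) by (auto simp: plus_prod_def prod_eq_iff)
  have "m * e < m * (f + 1)" using le(1) f(3) by simp
  then have "e \<le> f" unfolding mult_less_cancel1 by simp
  have "m * (?N - e) < m * (?N - f + 1)" using le(2) f(4) by simp
  then have "?N - e \<le> ?N - f" unfolding mult_less_cancel1 by simp
  then have "e = f" using \<open>e \<le> f\<close> e(2) f(2) by linarith
  with le e(5) f(5) have "r = r'" "d = d'" by auto
  with \<open>e = f\<close> e(1) f(1) \<open>h = g + s\<close> show ?thesis
    by (auto simp: plus_prod_def prod_eq_iff zero_prod_def)
qed

section \<open>Counting the minimal generators of a power\<close>

lemma finite_pgens: "finite (pgens A m k)"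
  by (simp add: pgens_def finite_expos)

text \<open>A quotient \<open>e\<close> in \<open>expos A k\<close> yields one generator and any
  other quotient up to \<open>(A + 1) * k\<close> yields \<open>m\<close>, one for each remainder.
  Uniqueness of division by \<open>m\<close> excludes coincidences.\<close>

lemma card_pgens:
  assumes m: "m \<ge> 1"
  shows "card (pgens A m k) = card (expos A k) + m * ((A + 1) * k + 1 - card (expos A k))"
proof -
  let ?N = "(A + 1) * k"
  let ?f = "\<lambda>e. (m * e, m * (?N - e))"
  let ?g = "\<lambda>(e, r). (m * e + r, m * (?N - e) + (m - 1 - r))"
  let ?S = "({..?N} - expos A k) \<times> {..<m}"
  have f: "inj_on ?f (expos A k)" using m by (auto simp: inj_on_def)
  have dm: "e = e' \<and> r = r'" if "m * e + r = m * e' + r'" "r < m" "r' < m" for e e' r r'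
  proof -
    have "(m * e + r) div m = e" using that(2) by simp
    moreover have "(m * e' + r') div m = e'" using that(3) by simp
    ultimately show ?thesis using that(1) by simp
  qed
  have g: "inj_on ?g ?S"
  proof (rule inj_onI)
    fix w w' assume w: "w \<in> ?S" "w' \<in> ?S" and eq: "?g w = ?g w'"
    obtain e r e' r' where "w = (e, r)" "w' = (e', r')" by (cases w; cases w')
    then show "w = w'" using w eq dm[of e r e' r'] by simp
  qed
  have "?f ` expos A k \<inter> ?g ` ?S = {}"
  proof (rule ccontr)
    assume "\<not> ?thesis"
    then obtain e f r where "e \<in> expos A k" "f \<notin> expos A k" "r < m" "m * e = m * f + r"
      by auto
    then show False using dm[of e 0 f r] m by simp
  qed
  then have "card (pgens A m k) = card (?f ` expos A k) + card (?g ` ?S)"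
    unfolding pgens_def by (intro card_Un_disjoint) (simp_all add: finite_expos)
  also have "\<dots> = card (expos A k) + card ({..?N} - expos A k) * m"
    by (simp only: card_image[OF f] card_image[OF g] card_cartesian_product card_lessThan)
  also have "card ({..?N} - expos A k) = ?N + 1 - card (expos A k)"
    by (subst card_Diff_subset) (auto simp: finite_expos dest: expos_le)
  finally show ?thesis by (simp add: mult.commute)
qed

text \<open>As \<open>j \<le> k < A\<close>, the pair \<open>(i, j)\<close> is recovered from
  \<open>A * i + j\<close> by division with remainder.\<close>

lemma card_expos_small:
  assumes "k < A"
  shows "card (expos A k) = (k + 1) ^ 2"
proof -
  have "expos A k = (\<lambda>(i, j). A * i + j) ` ({..k} \<times> {..k})"
    by (auto simp: expos_def)
  moreover have "inj_on (\<lambda>(i, j). A * i + j) ({..k} \<times> {..k})"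
  proof (rule inj_onI, clarsimp)
    fix i j i' j' assume le: "j \<le> k" "j' \<le> k" and eq: "A * i + j = A * i' + j'"
    have "(A * i + j) div A = i" "(A * i' + j') div A = i'" using le assms by auto
    then show "i = i' \<and> j = j'" using eq by simp
  qed
  ultimately show ?thesis
    by (simp add: card_image card_cartesian_product power2_eq_square)
qed

text \<open>Every remainder modulo \<open>A\<close> is at most \<open>A - 1 \<le> k\<close>, so
  division with remainder represents each \<open>q\<close> with quotient at most \<open>k\<close>.
  For larger \<open>q\<close> take \<open>i = k\<close>.\<close>

lemma card_expos_large:
  assumes "A \<ge> 1" "k + 1 \<ge> A"
  shows "card (expos A k) = (A + 1) * k + 1"
proof -
  have "expos A k = {..(A + 1) * k}"
  proof
    show "{..(A + 1) * k} \<subseteq> expos A k"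
    proof
      fix q assume q: "q \<in> {..(A + 1) * k}"
      show "q \<in> expos A k"
      proof (cases "q div A \<le> k")
        case True
        have "q mod A < A" using assms by simp
        then have "q mod A \<le> k" using assms by linarith
        moreover have "q = A * (q div A) + q mod A" by simp
        ultimately show ?thesis using True unfolding expos_def by blast
      next
        case False
        then have "A * Suc k \<le> q"

          using assms(1) less_eq_div_iff_mult_less_eq[of A "Suc k" q] by (simp add: mult.commute not_le Suc_le_eq)
        then have "q = A * k + (q - A * k)" "q - A * k \<le> k" using q by (auto simp: algebra_simps)
        then show ?thesis unfolding expos_def by blast
      qed
    qed
  qed (auto dest: expos_le)
  then show ?thesis by simp
qed

section \<open>From the given ideals to sets of exponent pairs\<close>

lemma degree_pow_Suc:
  "{(u, v). Suc n \<le> u + v} = {(u, v). n \<le> u + v} + {(u, v). 1 \<le> u \<or> 1 \<le> (v::nat)}"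
proof
  show "{(u, v). Suc n \<le> u + v} \<subseteq> {(u, v). n \<le> u + v} + {(u, v). 1 \<le> u \<or> 1 \<le> v}"
  proof
    fix w assume "w \<in> {(u, v). Suc n \<le> u + v}"
    then obtain u v where w: "w = (u, v)" "Suc n \<le> u + v" by auto
    show "w \<in> {(u, v). n \<le> u + v} + {(u, v). 1 \<le> u \<or> 1 \<le> v}"
    proof (cases u)
      case 0
      then show ?thesis
        using w by (intro set_plus_memI[of "(u, v - 1)" _ "(0, 1)"]) (auto simp: plus_prod_def)
    next
      case (Suc u')
      then show ?thesis
        using w by (intro set_plus_memI[of "(u', v)" _ "(1, 0)"]) (auto simp: plus_prod_def)
    qed
  qed
qed (auto simp: set_plus_def plus_prod_def)

lemma expos_1: "expos A 1 = {0, 1, A, A + 1}"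
proof
  show "{0, 1, A, A + 1} \<subseteq> expos A 1"
    using exposI[of 0 1 0 A] exposI[of 0 1 1 A] exposI[of 1 1 0 A] exposI[of 1 1 1 A] by simp
qed (auto simp: expos_def le_Suc_eq)

lemma ppow_1:
  assumes "m \<ge> 1"
  shows "ppow A m 1 = ({(u, v). A * m \<le> u \<or> A * m \<le> v} + {(u, v). m \<le> u \<or> m \<le> v}) \<union>
    {(u, v). (A + 2) * m - 1 \<le> u + v}" (is "_ = (?P + ?Q) \<union> ?D")
proof -
  \<comment> \<open>Moving 1 to the other side replaces the truncated subtraction in the exponent
    \<open>(A + 2) * m - 1\<close>.\<close>
  have D: "m * ((A + 1) * 1 + 1) \<le> u + v + 1 \<longleftrightarrow> (A + 2) * m - 1 \<le> u + v" for u v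
    by (simp add: algebra_simps) linarith
  have E: "(\<exists>e\<in>expos A 1. m * e \<le> u \<and> m * ((A + 1) * 1 - e) \<le> v) \<longleftrightarrow> (u, v) \<in> ?P + ?Q" for u v
  proof
    assume "\<exists>e\<in>expos A 1. m * e \<le> u \<and> m * ((A + 1) * 1 - e) \<le> v"
    then consider "m * (A + 1) \<le> v" | "m \<le> u" "m * A \<le> v" | "m * A \<le> u" "m \<le> v" | "m * (A + 1) \<le> u"
      unfolding expos_1 by auto
    then show "(u, v) \<in> ?P + ?Q"
    proof cases
      case 1
      then show ?thesis
        by (intro set_plus_memI[of "(0, A * m)" _ "(u, v - A * m)"]) (auto simp: plus_prod_def algebra_simps)
    next
      case 2
      then show ?thesis
        by (intro set_plus_memI[of "(0, v)" _ "(u, 0)"]) (auto simp: plus_prod_def algebra_simps)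
    next
      case 3
      then show ?thesis
        by (intro set_plus_memI[of "(u, 0)" _ "(0, v)"]) (auto simp: plus_prod_def algebra_simps)
    next
      case 4
      then show ?thesis
        by (intro set_plus_memI[of "(A * m, 0)" _ "(u - A * m, v)"]) (auto simp: plus_prod_def algebra_simps)
    qed
  next
    assume "(u, v) \<in> ?P + ?Q"
    then obtain u1 v1 u2 v2 where "u = u1 + u2" "v = v1 + v2" "A * m \<le> u1 \<or> A * m \<le> v1" "m \<le> u2 \<or> m \<le> v2"
      by (auto simp: set_plus_def plus_prod_def)
    then have "m * (A + 1) \<le> v \<or> (m \<le> u \<and> m * A \<le> v) \<or> (m * A \<le> u \<and> m \<le> v) \<or> m * (A + 1) \<le> u"
      by (simp add: algebra_simps) linarith
    then show "\<exists>e\<in>expos A 1. m * e \<le> u \<and> m * ((A + 1) * 1 - e) \<le> v"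
      unfolding expos_1 by auto
  qed
  show ?thesis unfolding ppow_def E D by auto
qed

lemma up_or: "{(u, v). n \<le> u \<or> n \<le> (v::nat)} + UNIV = {(u, v). n \<le> u \<or> n \<le> v}"
proof
  show "{(u, v). n \<le> u \<or> n \<le> v} \<subseteq> {(u, v). n \<le> u \<or> n \<le> v} + UNIV"
    by (rule subsetI, rule set_plus_memI[of _ _ 0]) auto
qed (auto simp: set_plus_def plus_prod_def)

lemma I_am_eq:
  assumes "m \<ge> 1"
  shows "I_am (X j) (Y j) A m = (mon_ideal (box {j} (\<lambda>_. ppow A m 1)) :: (xy, 'k::field) mpol set)"
proof -
  let ?R = "mpol_ring (pvars {j}) :: (xy, 'k) mpol ring"
  have V: "{X j, Y j} = pvars {j}" by (simp add: pvars_def insert_commute)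
  have "Idl\<^bsub>?R\<^esub> {var (X j), var (Y j)} = mon_ideal (box {j} (\<lambda>_. {(u, v). 1 \<le> u \<or> 1 \<le> v}))"
    using Idl_var_powers[of j 1, where 'k = 'k] by simp
  then have "(Idl\<^bsub>?R\<^esub> {var (X j), var (Y j)}) [^]\<^bsub>ideals_set ?R\<^esub> n =
      mon_ideal (box {j} (\<lambda>_. {(u, v). n \<le> u + v}))" for n :: nat
    using pow_box[of "{j}" "\<lambda>_. {(u, v). 1 \<le> u \<or> 1 \<le> v}" "\<lambda>_ n. {(u, v). n \<le> u + v}" n]
    by (simp only:) (simp add: up_or degree_pow_Suc del: One_nat_def)
  moreover have "(Idl\<^bsub>?R\<^esub> {var (X j) ^ (A * m), var (Y j) ^ (A * m)}) \<cdot>\<^bsub>?R\<^esub>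
      (Idl\<^bsub>?R\<^esub> {var (X j) ^ m, var (Y j) ^ m}) =
      mon_ideal (box {j} (\<lambda>_. {(u, v). A * m \<le> u \<or> A * m \<le> v} + {(u, v). m \<le> u \<or> m \<le> v}))"
    unfolding Idl_var_powers by (rule ideal_prod_box) (simp_all add: up_or)
  ultimately show ?thesis
    by (simp only: I_am_def Let_def V set_add_mon_ideal box_Un ppow_1[OF assms])
qed

lemma num_gens_I_prod_pow:
  assumes "a \<ge> 1"
  shows "num_gens (mpol_ring (xy_vars l))
      ((I_prod a l :: (xy, 'k::field) mpol set) [^]\<^bsub>ideals_set (mpol_ring (xy_vars l))\<^esub> (k::nat)) =
    (\<Prod>j\<in>{1..l}. card (pgens (j * a) a k))"
proof -
  let ?J = "{1..l}"
  let ?R = "mpol_ring (pvars ?J) :: (xy, 'k) mpol ring"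
  have V: "xy_vars l = pvars ?J" by (simp add: xy_vars_def pvars_def)
  have "I_prod a l = (\<Otimes>\<^bsub>ideals_set ?R\<^esub>j\<in>?J. Idl\<^bsub>?R\<^esub> (I_am (X j) (Y j) (j * a) a))"
    by (simp only: I_prod_def Let_def V)
  also have "\<dots> = mon_ideal (box ?J (\<lambda>i. if i \<in> ?J then ppow (i * a) a 1 else UNIV))"
  proof (rule finprod_box)
    fix j assume j: "j \<in> ?J"
    have "box {j} (\<lambda>_. ppow (j * a) a 1) \<subseteq> monoms (pvars ?J)"
      using box_subset[of "{j}" "\<lambda>_. ppow (j * a) a 1"] monoms_mono[of "pvars {j}" "pvars ?J"] j
      by (auto simp: pvars_def)
    then show "Idl\<^bsub>?R\<^esub> (I_am (X j) (Y j) (j * a) a) =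
        mon_ideal (box ?J (\<lambda>i. if i = j then ppow (j * a) a 1 else UNIV))"
      using j by (simp only: I_am_eq[OF assms] Idl_mon_ideal box_single_plus_monoms ppow_up finite_atLeastAtMost)
  qed (simp_all add: ppow_up)
  also have "box ?J (\<lambda>i. if i \<in> ?J then ppow (i * a) a 1 else UNIV) = box ?J (\<lambda>i. ppow (i * a) a 1)"
    by (rule box_cong) simp
  finally have "I_prod a l [^]\<^bsub>ideals_set ?R\<^esub> k =
      mon_ideal (box ?J (\<lambda>i. ppow (i * a) a 1)) [^]\<^bsub>ideals_set ?R\<^esub> k"
    by (rule arg_cong)
  also have "\<dots> = mon_ideal (box ?J (\<lambda>i. ppow (i * a) a k))"
  proof (rule pow_box)
    fix j k assume "j \<in> ?J"
    then show "ppow (j * a) a (Suc k) = ppow (j * a) a k + ppow (j * a) a 1"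
      using assms by (intro ppow_Suc) auto
  qed (simp_all add: ppow_up ppow_0)
  also have "box ?J (\<lambda>i. ppow (i * a) a k) = box ?J (\<lambda>i. pgens (i * a) a k + UNIV)"
    by (simp add: pgens_plus[OF assms])
  finally show ?thesis
    unfolding V
    by (simp only:, intro num_gens_box)
      (auto simp: finite_pgens dest: pgens_antichain[OF assms])
qed

lemma card_pgens_large:
  assumes "A \<ge> 1" "m \<ge> 1" "k + 1 \<ge> A"
  shows "real (card (pgens A m k)) = (real A + 1) * real k + 1"
  using assms by (simp add: card_pgens card_expos_large algebra_simps)

lemma card_pgens_small:
  assumes "m \<ge> 1" "k < A"
  shows "real (card (pgens A m k)) = (real k + 1)\<^sup>2 + real m * real k * (real A - 1 - real k)"
proof -
  \<comment> \<open>Thus \<open>k * (A - 1 - k)\<close> quotients lie outside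
    \<open>expos A k\<close>, and each of them contributes \<open>m\<close> generators.\<close>
  have "(A + 1) * k + 1 = (k + 1)\<^sup>2 + k * (A - 1 - k)"
  proof -
    obtain d where "A = k + 1 + d" using assms(2) by (metis Suc_eq_plus1 Suc_leI le_iff_add)
    then show ?thesis by (simp add: power2_eq_square algebra_simps)
  qed
  then have "card (pgens A m k) = (k + 1)\<^sup>2 + m * (k * (A - 1 - k))"
    using assms by (simp add: card_pgens card_expos_small)
  then have "real (card (pgens A m k)) = (real k + 1)\<^sup>2 + real m * (real k * real (A - 1 - k))"
    by simp
  also have "real (A - 1 - k) = real A - 1 - real k" using assms(2) by (simp add: of_nat_diff)
  finally show ?thesis by (simp add: mult.assoc)
qed

section \<open>Growth of the number of generators\<close>

text \<open>The parameter a is taken even, \<open>a = 2 * b\<close>, so that the intended peak at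
  \<open>(p + 1/2) a\<close> is the integer \<open>p * (2 * b) + b\<close>.\<close>

lemma filterlim_inverse_twice: "(\<lambda>b. 1 / real (2 * b)) \<longlonglongrightarrow> 0"
proof -
  have "(\<lambda>b. (1 / 2) * (1 / real b)) \<longlonglongrightarrow> (1 / 2) * 0"
    by (intro tendsto_mult tendsto_const lim_1_over_n)
  then show ?thesis by simp
qed

lemma tendsto_card_pgens_large:
  assumes c: "(\<lambda>b. real (k b) / real (2 * b)) \<longlonglongrightarrow> c"
    and j: "j \<ge> 1" and large: "\<And>b. b \<ge> 1 \<Longrightarrow> j * (2 * b) \<le> k b + 1"
  shows "(\<lambda>b. real (card (pgens (j * (2 * b)) (2 * b) (k b))) / real (2 * b) ^ 2) \<longlonglongrightarrow> real j * c"
proof (rule Lim_transform_eventually)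
  have "(\<lambda>b. (real j + 1 / real (2 * b)) * (real (k b) / real (2 * b)) + (1 / real (2 * b))\<^sup>2)
      \<longlonglongrightarrow> (real j + 0) * c + 0\<^sup>2"
    by (intro tendsto_intros c filterlim_inverse_twice)
  then show "(\<lambda>b. (real j + 1 / real (2 * b)) * (real (k b) / real (2 * b)) + (1 / real (2 * b))\<^sup>2)
      \<longlonglongrightarrow> real j * c" by simp
  show "\<forall>\<^sub>F b in sequentially. (real j + 1 / real (2 * b)) * (real (k b) / real (2 * b)) + (1 / real (2 * b))\<^sup>2
      = real (card (pgens (j * (2 * b)) (2 * b) (k b))) / real (2 * b) ^ 2"
    using eventually_ge_at_top[of 1]
  proof eventually_elim
    case (elim b)
    define x where "x = real (2 * b)"
    have x: "x > 0" using elim by (simp add: x_def)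
    have eq: "real (card (pgens (j * (2 * b)) (2 * b) (k b))) = (real j * x + 1) * real (k b) + 1"
      using elim j large[OF elim] by (subst card_pgens_large) (auto simp: x_def)
    show ?case unfolding eq x_def[symmetric] using x by (simp add: field_simps power2_eq_square)
  qed
qed

lemma tendsto_card_pgens_small:
  assumes c: "(\<lambda>b. real (k b) / real (2 * b)) \<longlonglongrightarrow> c"
    and small: "\<And>b. b \<ge> 1 \<Longrightarrow> k b < j * (2 * b)"
  shows "(\<lambda>b. real (card (pgens (j * (2 * b)) (2 * b) (k b))) / real (2 * b) ^ 3) \<longlonglongrightarrow> c * (real j - c)"
proof (rule Lim_transform_eventually)
  let ?g = "\<lambda>b. (real (k b) / real (2 * b) + 1 / real (2 * b))\<^sup>2 * (1 / real (2 * b)) +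
      (real (k b) / real (2 * b)) * (real j - 1 / real (2 * b) - real (k b) / real (2 * b))"
  have "?g \<longlonglongrightarrow> (c + 0)\<^sup>2 * 0 + c * (real j - 0 - c)"
    by (intro tendsto_intros c filterlim_inverse_twice)
  then show "?g \<longlonglongrightarrow> c * (real j - c)" by simp
  show "\<forall>\<^sub>F b in sequentially. ?g b = real (card (pgens (j * (2 * b)) (2 * b) (k b))) / real (2 * b) ^ 3"
    using eventually_ge_at_top[of 1]
  proof eventually_elim
    case (elim b)
    define x where "x = real (2 * b)"
    have x: "x > 0" using elim by (simp add: x_def)
    have eq: "real (card (pgens (j * (2 * b)) (2 * b) (k b))) =
        (real (k b) + 1)\<^sup>2 + x * real (k b) * (real j * x - 1 - real (k b))"
      using elim small[OF elim] by (subst card_pgens_small) (auto simp: x_def)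
    show ?case unfolding eq x_def[symmetric] using x
      by (simp add: field_simps power2_eq_square power3_eq_cube)
  qed
qed

text \<open>The factors are the ratios by which \<open>j - c\<close> shrinks when c moves from p to
  p + 1/2. Both sides equal 1/2 for \<open>l = p + 1\<close>; in the induction step the new bound is
  smaller than the old one times the new factor, with difference
  \<open>1 / (4 * x * (x + 1))\<close>.\<close>

lemma prod_lower_bound:
  assumes "p < l"
  shows "(\<Prod>j\<in>{1..l}. if j \<le> p then 1 else 1 - 1 / (2 * (real j - real p))) \<ge> 1 / (2 * (real l - real p))"
proof -
  from assms have "Suc p \<le> l" by simp
  then show ?thesis
  proof (induction l rule: dec_induct)
    case base
    have "(\<Prod>j\<in>{1..p}. if j \<le> p then 1 else 1 - 1 / (2 * (real j - real p))) = 1"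
      by (intro prod.neutral) auto
    then show ?case by simp
  next
    case (step n)
    define x where "x = real n - real p"
    have x: "x \<ge> 1" using step.hyps by (simp add: x_def)
    have "1 / (2 * x) * (1 - 1 / (2 * (x + 1))) - 1 / (2 * (x + 1)) = 1 / (4 * x * (x + 1))"
      using x by (simp add: divide_simps)
    moreover have "1 / (4 * x * (x + 1)) \<ge> 0" using x by simp
    ultimately have "1 / (2 * (x + 1)) \<le> 1 / (2 * x) * (1 - 1 / (2 * (x + 1)))" by linarith
    also have "\<dots> \<le> (\<Prod>j\<in>{1..n}. if j \<le> p then 1 else 1 - 1 / (2 * (real j - real p))) *
        (1 - 1 / (2 * (x + 1)))"
      using step.IH x by (intro mult_right_mono) (simp_all add: x_def)
    finally show ?case using step.hyps by (simp add: x_def algebra_simps)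
  qed
qed

text \<open>The product of the leading coefficients of \<open>\<mu>(I\<^sup>k)\<close> at \<open>k = c a\<close>; the first \<open>p\<close> factors
  grow like \<open>a\<^sup>2\<close>, the others like \<open>a\<^sup>3\<close>.\<close>

definition lead :: "nat \<Rightarrow> nat \<Rightarrow> real \<Rightarrow> real" where
  "lead l p c = (\<Prod>j\<in>{1..l}. if j \<le> p then real j * c else c * (real j - c))"

lemma lead_pos: "p \<ge> 1 \<Longrightarrow> lead l p (real p) > 0"
  unfolding lead_def by (rule prod_pos) auto

text \<open>Passing from c = p to c = p + 1/2 multiplies each of the \<open>l\<close> factors by
  \<open>1 + 1 / (2 * p)\<close>, and those with \<open>j > p\<close> also by a shrinking ratio. The
  gain is exponential in \<open>l\<close>, while the loss is at most the linear factor
  \<open>2 * (l - p)\<close>.\<close>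

lemma lead_less:
  assumes p: "1 \<le> p" "p \<le> q" "q < l" and l: "2 * real l < (1 + 1 / (2 * real q)) ^ l"
  shows "lead l p (real p) < lead l p (real p + 1 / 2)"
proof -
  let ?h = "\<lambda>j. if j \<le> p then 1 else 1 - 1 / (2 * (real j - real p))"
  have "lead l p (real p + 1 / 2) =
      (\<Prod>j\<in>{1..l}. (if j \<le> p then real j * real p else real p * (real j - real p)) *
        ((1 + 1 / (2 * real p)) * ?h j))"
    unfolding lead_def
  proof (intro prod.cong refl)
    fix j
    have P: "real p * (1 + 1 / (2 * real p)) = real p + 1 / 2"
      using p(1) by (simp add: field_simps)
    show "(if j \<le> p then real j * (real p + 1 / 2) else (real p + 1 / 2) * (real j - (real p + 1 / 2))) =
        (if j \<le> p then real j * real p else real p * (real j - real p)) *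
        ((1 + 1 / (2 * real p)) * ?h j)"
    proof (cases "j \<le> p")
      case False
      then have "(real j - real p) * ?h j = real j - (real p + 1 / 2)"
        by (simp add: field_simps)
      then show ?thesis using False unfolding P[symmetric] by (simp add: mult_ac)
    next
      case True
      then show ?thesis unfolding P[symmetric] by simp
    qed
  qed
  also have "\<dots> = lead l p (real p) * ((1 + 1 / (2 * real p)) ^ l * (\<Prod>j\<in>{1..l}. ?h j))"
    by (simp add: lead_def prod.distrib)
  finally have eq: "lead l p (real p + 1 / 2) =
      lead l p (real p) * ((1 + 1 / (2 * real p)) ^ l * (\<Prod>j\<in>{1..l}. ?h j))" .
  have "1 < 2 * real l * (1 / (2 * (real l - real p)))"
    using p by (simp add: field_simps)
  also have "\<dots> \<le> (1 + 1 / (2 * real p)) ^ l * (1 / (2 * (real l - real p)))"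
  proof (rule mult_right_mono)
    have "(1 + 1 / (2 * real q)) ^ l \<le> (1 + 1 / (2 * real p)) ^ l"
      using p by (intro power_mono add_mono) (auto simp: field_simps)
    with l show "2 * real l \<le> (1 + 1 / (2 * real p)) ^ l" by simp
  qed (use p in simp)
  also have "\<dots> \<le> (1 + 1 / (2 * real p)) ^ l * (\<Prod>j\<in>{1..l}. ?h j)"
    using prod_lower_bound[of p l] p by (intro mult_left_mono) auto
  finally show ?thesis unfolding eq using lead_pos[OF p(1), of l] by simp
qed

text \<open>Exponential growth beats linear growth: \<open>n / x ^ n\<close> tends to 0 for
  \<open>x > 1\<close>.\<close>

lemma ex_lead_less:
  fixes q :: nat
  assumes "q \<ge> 1"
  obtains l where "q < l" "2 * real l < (1 + 1 / (2 * real q)) ^ l"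
proof -
  define x where "x = 1 + 1 / (2 * real q)"
  have x: "x > 1" using assms by (simp add: x_def)
  then have "(\<lambda>n. real n * (1 / x) ^ n) \<longlonglongrightarrow> 0"
    by (intro powser_times_n_limit_0) simp
  then have "eventually (\<lambda>n. real n * (1 / x) ^ n < 1 / 2) sequentially"
    by (rule order_tendstoD) simp
  then have "eventually (\<lambda>n. n > q \<and> real n * (1 / x) ^ n < 1 / 2) sequentially"
    by (intro eventually_conj eventually_gt_at_top)
  then obtain l where l: "l > q" "real l * (1 / x) ^ l < 1 / 2"
    by (metis (mono_tags, lifting) eventually_at_top_linorder order_refl)
  have "2 * real l < x ^ l"
    using l(2) x by (simp add: power_one_over field_simps)
  with l(1) that show ?thesis by (simp add: x_def)
qed

text \<open>The condition for \<open>j \<le> p\<close> matches the range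
  \<open>k + 1 \<ge> A\<close> of the linear formula, so it admits the argument
  \<open>p * (2 * b) - 1\<close>, just before a multiple of a.\<close>

lemma tendsto_lead:
  assumes c: "(\<lambda>b. real (k b) / real (2 * b)) \<longlonglongrightarrow> c"
    and large: "\<And>b j. b \<ge> 1 \<Longrightarrow> j \<le> p \<Longrightarrow> j * (2 * b) \<le> k b + 1"
    and small: "\<And>b j. b \<ge> 1 \<Longrightarrow> p < j \<Longrightarrow> k b < j * (2 * b)"
  shows "(\<lambda>b. real (\<Prod>j\<in>{1..l}. card (pgens (j * (2 * b)) (2 * b) (k b))) /
    (\<Prod>j\<in>{1..l}. real (2 * b) ^ (if j \<le> p then 2 else 3))) \<longlonglongrightarrow> lead l p c"
proof -
  have "(\<lambda>b. \<Prod>j\<in>{1..l}. real (card (pgens (j * (2 * b)) (2 * b) (k b))) /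
      real (2 * b) ^ (if j \<le> p then 2 else 3)) \<longlonglongrightarrow> lead l p c"
    unfolding lead_def
  proof (rule tendsto_prod)
    fix j assume "j \<in> {1..l}"
    then show "(\<lambda>b. real (card (pgens (j * (2 * b)) (2 * b) (k b))) /
        real (2 * b) ^ (if j \<le> p then 2 else 3)) \<longlonglongrightarrow> (if j \<le> p then real j * c else c * (real j - c))"
      using tendsto_card_pgens_large[OF c, of j] tendsto_card_pgens_small[OF c, of j] large small
      by (cases "j \<le> p") simp_all
  qed
  then show ?thesis by (simp only: prod_dividef of_nat_prod)
qed

text \<open>Divided by the common weight \<open>w\<close>, the values at the left end, the middle
  and the right end tend to \<open>lead l p p\<close>, to the larger
  \<open>lead l p (p + 1/2)\<close>, and to 0.\<close>

lemma eventually_peak: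
  assumes p: "1 \<le> p" "p \<le> q" "q < l" and l: "2 * real l < (1 + 1 / (2 * real q)) ^ l"
  defines "f \<equiv> \<lambda>b k. \<Prod>j\<in>{1..l}. card (pgens (j * (2 * b)) (2 * b) k)"
  shows "eventually (\<lambda>b. f b (p * (2 * b)) < f b (p * (2 * b) + b) \<and>
    f b ((p + 1) * (2 * b) - 1) < f b (p * (2 * b) + b)) sequentially"
proof -
  define w where "w b = (\<Prod>j\<in>{1..l}. real (2 * b) ^ (if j \<le> p then 2 else 3))" for b :: nat
  \<comment> \<open>The weight suited to the right end, where the factor with
    \<open>j = p + 1\<close> has only order a^2. It is smaller than \<open>w\<close> by one factor
    a.\<close>
  define w' where "w' b = (\<Prod>j\<in>{1..l}. real (2 * b) ^ (if j \<le> p + 1 then 2 else 3))" for b :: nat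
  have le: "j * (2 * b) \<le> n * (2 * b)" if "j \<le> n" for j n b :: nat
    using that by (intro mult_right_mono) auto
  have less: "n * (2 * b) + 2 * b \<le> j * (2 * b)" if "n < j" for j n b :: nat
    using le[of "n + 1" j b] that by (simp add: algebra_simps)
  have s: "(\<lambda>b. real (f b (p * (2 * b))) / w b) \<longlonglongrightarrow> lead l p (real p)"
    unfolding f_def w_def
  proof (rule tendsto_lead)
    have "\<forall>\<^sub>F b in sequentially. real p = real (p * (2 * b)) / real (2 * b)"
      using eventually_ge_at_top[of 1] by eventually_elim simp
    then show "(\<lambda>b. real (p * (2 * b)) / real (2 * b)) \<longlonglongrightarrow> real p"
      by (rule Lim_transform_eventually[OF tendsto_const])
  next
    fix b j :: nat assume "1 \<le> b" "j \<le> p"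
    then show "j * (2 * b) \<le> p * (2 * b) + 1" using le[of j p b] by linarith
  next
    fix b j :: nat assume "1 \<le> b" "p < j"
    then show "p * (2 * b) < j * (2 * b)" using less[of p j b] by linarith
  qed
  have r: "(\<lambda>b. real (f b (p * (2 * b) + b)) / w b) \<longlonglongrightarrow> lead l p (real p + 1 / 2)"
    unfolding f_def w_def
  proof (rule tendsto_lead)
    have "\<forall>\<^sub>F b in sequentially. real p + 1 / 2 = real (p * (2 * b) + b) / real (2 * b)"
      using eventually_ge_at_top[of 1] by eventually_elim (simp add: field_simps)
    then show "(\<lambda>b. real (p * (2 * b) + b) / real (2 * b)) \<longlonglongrightarrow> real p + 1 / 2"
      by (rule Lim_transform_eventually[OF tendsto_const])
  next
    fix b j :: nat assume "1 \<le> b" "j \<le> p"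
    then show "j * (2 * b) \<le> p * (2 * b) + b + 1" using le[of j p b] by linarith
  next
    fix b j :: nat assume "1 \<le> b" "p < j"
    then show "p * (2 * b) + b < j * (2 * b)" using less[of p j b] by linarith
  qed
  have "(\<lambda>b. real (f b ((p + 1) * (2 * b) - 1)) / w' b) \<longlonglongrightarrow> lead l (p + 1) (real (p + 1))"
    unfolding f_def w'_def
  proof (rule tendsto_lead)
    have "(\<lambda>b. real (p + 1) - 1 / real (2 * b)) \<longlonglongrightarrow> real (p + 1) - 0"
      by (intro tendsto_intros filterlim_inverse_twice)
    moreover have "\<forall>\<^sub>F b in sequentially.
        real (p + 1) - 1 / real (2 * b) = real ((p + 1) * (2 * b) - 1) / real (2 * b)"
      using eventually_ge_at_top[of 1]
    proof eventually_elim
      case (elim b)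
      have "real ((p + 1) * (2 * b) - 1) = real (p + 1) * real (2 * b) - 1"
        using elim by (subst of_nat_diff) (simp_all add: algebra_simps)
      then show ?case using elim by (simp add: diff_divide_distrib)
    qed
    ultimately show "(\<lambda>b. real ((p + 1) * (2 * b) - 1) / real (2 * b)) \<longlonglongrightarrow> real (p + 1)"
      using Lim_transform_eventually by fastforce
  next
    fix b j :: nat assume "1 \<le> b" "j \<le> p + 1"
    then show "j * (2 * b) \<le> (p + 1) * (2 * b) - 1 + 1" using le[of j "p + 1" b] by linarith
  next
    fix b j :: nat assume "1 \<le> b" "p + 1 < j"
    then show "(p + 1) * (2 * b) - 1 < j * (2 * b)" using less[of "p + 1" j b] by linarith
  qed
  then have "(\<lambda>b. (real (f b ((p + 1) * (2 * b) - 1)) / w' b) * (1 / real (2 * b))) \<longlonglongrightarrow>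
      lead l (p + 1) (real (p + 1)) * 0"
    by (intro tendsto_mult filterlim_inverse_twice)
  moreover have "w b = w' b * real (2 * b)" for b
  proof -
    have "w b = (\<Prod>j\<in>{1..l}. real (2 * b) ^ (if j \<le> p + 1 then 2 else 3) *
        (if j = p + 1 then real (2 * b) else 1))"
      unfolding w_def by (intro prod.cong refl) (auto simp: power2_eq_square power3_eq_cube)
    also have "\<dots> = w' b * real (2 * b)"
      using p by (simp add: w'_def prod.distrib prod.delta)
    finally show ?thesis .
  qed
  ultimately have t: "(\<lambda>b. real (f b ((p + 1) * (2 * b) - 1)) / w b) \<longlonglongrightarrow> 0"
    by simp
  define M where "M = lead l p (real p + 1 / 2)"
  have M: "lead l p (real p) < M" "0 < M"
    using lead_less[OF p l] lead_pos[OF p(1), of l] by (simp_all add: M_def)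
  \<comment> \<open>A threshold strictly between the limits; positivity of \<open>y\<close> makes it
    serve against the limit 0 as well.\<close>
  obtain y where y: "lead l p (real p) < y" "y < M" using dense[OF M(1)] by blast
  then have y0: "0 < y" using lead_pos[OF p(1), of l] by linarith
  from order_tendstoD(2)[OF s y(1)] order_tendstoD(1)[OF r[folded M_def] y(2)]
    order_tendstoD(2)[OF t y0] eventually_ge_at_top[of 1]
  show ?thesis
  proof eventually_elim
    case (elim b)
    have w: "w b > 0" unfolding w_def using elim(4) by (intro prod_pos) simp
    have "real (f b (p * (2 * b))) / w b < real (f b (p * (2 * b) + b)) / w b"
      "real (f b ((p + 1) * (2 * b) - 1)) / w b < real (f b (p * (2 * b) + b)) / w b"
      using elim by linarith+
    then show ?case using w by (simp add: divide_less_cancel)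
  qed
qed

theorem theorem3p1:
  fixes q :: nat
  assumes "q \<ge> 1"
  shows "\<exists>a l :: nat. a \<ge> 3 \<and> l \<ge> 1 \<and>
    (let R = (mpol_ring (xy_vars l) :: (xy, 'k::field) mpol ring);
         I = I_prod a l
     in has_local_maxima q (\<lambda>k. num_gens R (I [^]\<^bsub>ideals_set R\<^esub> k)))"
proof -
  obtain l where l: "q < l" "2 * real l < (1 + 1 / (2 * real q)) ^ l" using assms by (rule ex_lead_less)
  define f where "f b k = (\<Prod>j\<in>{1..l}. card (pgens (j * (2 * b)) (2 * b) k))" for b k
  \<comment> \<open>Only finitely many \<open>p\<close> are involved, so a single \<open>b\<close>
    serves for all of them.\<close>
  have "eventually (\<lambda>b. \<forall>p\<in>{1..q}. f b (p * (2 * b)) < f b (p * (2 * b) + b) \<and>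
      f b ((p + 1) * (2 * b) - 1) < f b (p * (2 * b) + b)) sequentially"
    unfolding f_def by (intro eventually_ball_finite ballI eventually_peak[of _ q]) (use l in auto)
  then have "eventually (\<lambda>b. b \<ge> 2 \<and> (\<forall>p\<in>{1..q}. f b (p * (2 * b)) < f b (p * (2 * b) + b) \<and>
      f b ((p + 1) * (2 * b) - 1) < f b (p * (2 * b) + b))) sequentially"
    by (intro eventually_conj eventually_ge_at_top)
  then obtain b where b: "b \<ge> 2" "\<And>p. p \<in> {1..q} \<Longrightarrow> f b (p * (2 * b)) < f b (p * (2 * b) + b) \<and>
      f b ((p + 1) * (2 * b) - 1) < f b (p * (2 * b) + b)"
    by (metis (mono_tags, lifting) eventually_at_top_linorder order_refl)
  have "has_local_maxima q (f b)"
    unfolding has_local_maxima_def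
  proof (intro exI conjI ballI)
    \<comment> \<open>The witnesses are fixed by the following statements: with
      \<open>a = 2 * b\<close>, the interval runs from \<open>i * a\<close> to
      \<open>(i + 1) * a - 1\<close> and has its peak at \<open>i * a + b\<close>. The peak lies
      strictly before the right end because \<open>b \<ge> 2\<close>.\<close>
    fix i assume i: "i \<in> {1..q}"
    show "0 < i * (2 * b)" "i * (2 * b) < i * (2 * b) + b" using i b(1) by auto
    show "i * (2 * b) + b < (i + 1) * (2 * b) - 1" using b(1) by (simp add: algebra_simps)
    show "f b (i * (2 * b)) < f b (i * (2 * b) + b)"
      "f b ((i + 1) * (2 * b) - 1) < f b (i * (2 * b) + b)" using b(2)[OF i] by auto
  next
    \<comment> \<open>The index is the quotient of any point of the interval by a, so distinct
      intervals share no point.\<close>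
    have "x div (2 * b) = i" if "x \<in> {i * (2 * b)..(i + 1) * (2 * b) - 1}" for x i
    proof (rule div_nat_eqI)
      have "0 < (i + 1) * (2 * b)" using b(1) by simp
      with that show "x < 2 * b * Suc i" by (simp add: algebra_simps) linarith
    qed (use that in \<open>simp add: mult.commute\<close>)
    then show "disjoint_family_on (\<lambda>i. {i * (2 * b)..(i + 1) * (2 * b) - 1}) {1..q}"
      unfolding disjoint_family_on_def by blast
  qed
  moreover have "num_gens (mpol_ring (xy_vars l))
      ((I_prod (2 * b) l :: (xy, 'k) mpol set) [^]\<^bsub>ideals_set (mpol_ring (xy_vars l))\<^esub> k) = f b k" for k :: nat
    unfolding f_def by (rule num_gens_I_prod_pow) (use b in simp)
  ultimately show ?thesis
    using b(1) l(1) by (intro exI[of _ "2 * b"] exI[of _ l]) (simp add: Let_def)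
qed

end
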